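(* Let $G=(V,E)$ be a $2$-edge-connected undirected graph and let $D_1, D_2$ be strongly connected orientations of $G$. Then there exists a path connecting $D_1$ and $D_2$ in the edge-flip graph $\mathcal{G}_1(G)$ if and only if there exists no $2$-edge-cut $\{\{u,v\},\{u',v'\}\}$ of $G$ such that $(u,v),(v',u')$ are edges of $D_1$ and $(v,u),(u',v')$ are edges of $D_2$ (that is, such that both edges of the cut are oriented oppositely in $D_1$ and in $D_2$). Furthermore, a shortest path in $\mathcal{G}_1(G)$ between two strongly connected orientations can be found in polynomial time if one exists.
   Context: Graphs are finite; multiple edges are allowed, and each edge joins two distinct vertices. An undirected graph $G=(V,E)$ is $m$-edge-connected if every non-empty $S\subsetneq V$ has at least $m$ edges with exactly one endpoint in $S$. For $S\subseteq V$, the set $E_G(S)$ of edges with exactly one endpoint in $S$ is called a $2$-edge-cut if $|E_G(S)|=2$. An orientation of $G$ is a directed graph obtained by choosing, for each undirected edge $\{u,v\}\in E$, one of the directed edges $(u,v)$ or $(v,u)$; parallel edges are distinguished and oriented individually, and statements about the directions of an edge of $G$ in $D_1$ and $D_2$ refer to the same edge of $G$. A directed graph is strongly connected (equivalently, $1$-edge-connected) if every non-empty $S\subsetneq V$ has at least one edge leaving $S$ and at least one edge entering $S$. An edge flip reverses the direction of exactly one directed edge. The edge-flip graph $\mathcal{G}_1(G)$ is the undirected graph whose vertices are all strongly connected orientations of $G$, two orientations being adjacent if and only if one is obtained from the other by a single edge flip. *)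

theory Defs
  imports "Graph_Theory.Graph_Theory" "HOL-Computational_Algebra.Polynomial"
begin

section \<open>Undirected multigraphs\<close>

record ('v, 'e) multigraph =
  vertices :: "'v set"
  edges :: "'e set"
  ends :: "'e \<Rightarrow> 'v set"

definition multigraph :: "('v, 'e) multigraph \<Rightarrow> bool" where
  "multigraph G \<longleftrightarrow> finite (vertices G) \<and> finite (edges G) \<and>
     (\<forall>e \<in> edges G. ends G e \<subseteq> vertices G \<and> card (ends G e) = 2)"

definition cut :: "('v, 'e) multigraph \<Rightarrow> 'v set \<Rightarrow> 'e set" where
  "cut G S = {e \<in> edges G. card (ends G e \<inter> S) = 1}"

definition edge_connected :: "nat \<Rightarrow> ('v, 'e) multigraph \<Rightarrow> bool" where
  "edge_connected m G \<longleftrightarrow>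
     (\<forall>S. S \<noteq> {} \<and> S \<subset> vertices G \<longrightarrow> card (cut G S) \<ge> m)"

definition two_edge_cut :: "('v, 'e) multigraph \<Rightarrow> 'e set \<Rightarrow> bool" where
  "two_edge_cut G C \<longleftrightarrow> (\<exists>S. S \<subseteq> vertices G \<and> C = cut G S \<and> card C = 2)"

section \<open>Orientations\<close>

text \<open>An arc of an orientation keeps the name of the edge that it orients. Tail and head are
  pinned outside the edge set, so that two orientations are equal as records as soon as they
  direct every edge in the same way.\<close>

definition orientation :: "('v, 'e) multigraph \<Rightarrow> ('v, 'e) pre_digraph \<Rightarrow> bool" where
  "orientation G D \<longleftrightarrow> verts D = vertices G \<and> arcs D = edges G \<and>
     (\<forall>e \<in> edges G. {tail D e, head D e} = ends G e) \<and>
     (\<forall>e. e \<notin> edges G \<longrightarrow> tail D e = undefined \<and> head D e = undefined)"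

text \<open>Strong connectivity in its cut form. The library's \<open>strongly_connected\<close> is stated in
  terms of reachability.\<close>

definition strong :: "('v, 'e) pre_digraph \<Rightarrow> bool" where
  "strong D \<longleftrightarrow> (\<forall>S. S \<noteq> {} \<and> S \<subset> verts D \<longrightarrow>
     (\<exists>a \<in> arcs D. tail D a \<in> S \<and> head D a \<in> verts D - S) \<and>
     (\<exists>a \<in> arcs D. tail D a \<in> verts D - S \<and> head D a \<in> S))"

definition strong_orientation :: "('v, 'e) multigraph \<Rightarrow> ('v, 'e) pre_digraph \<Rightarrow> bool" where
  "strong_orientation G D \<longleftrightarrow> orientation G D \<and> strong D"

section \<open>The edge-flip graph\<close>

definition flip :: "'e \<Rightarrow> ('v, 'e) pre_digraph \<Rightarrow> ('v, 'e) pre_digraph" where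
  "flip e D = D\<lparr>tail := (tail D)(e := head D e), head := (head D)(e := tail D e)\<rparr>"

text \<open>As usual in the digraph library, the undirected graph is the symmetric digraph that has
  both pairs for each edge.\<close>

definition edge_flip_graph ::
    "('v, 'e) multigraph \<Rightarrow> ('v, 'e) pre_digraph pair_pre_digraph" where
  "edge_flip_graph G =
     \<lparr> pverts = {D. strong_orientation G D},
       parcs = {(D, D'). strong_orientation G D \<and> strong_orientation G D' \<and>
                  (\<exists>e \<in> edges G. D' = flip e D \<or> D = flip e D')} \<rparr>"

definition flip_path ::
    "('v, 'e) multigraph \<Rightarrow> ('v, 'e) pre_digraph \<Rightarrow> ('v, 'e) pre_digraph list \<Rightarrow>
     ('v, 'e) pre_digraph \<Rightarrow> bool" where
  "flip_path G D1 p D2 \<longleftrightarrow>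
     vpath p (with_proj (edge_flip_graph G)) \<and> hd p = D1 \<and> last p = D2"

definition shortest_flip_path ::
    "('v, 'e) multigraph \<Rightarrow> ('v, 'e) pre_digraph \<Rightarrow> ('v, 'e) pre_digraph list \<Rightarrow>
     ('v, 'e) pre_digraph \<Rightarrow> bool" where
  "shortest_flip_path G D1 p D2 \<longleftrightarrow> flip_path G D1 p D2 \<and>
     (\<forall>q. flip_path G D1 q D2 \<longrightarrow> vwalk_length p \<le> vwalk_length q)"

section \<open>Polynomial time\<close>

text \<open>The machine model is the language WHILE of N. D. Jones, Computability and Complexity from
  a Programming Perspective (MIT Press, 1997), without its equality test and with a conditional.
  Programs compute on binary trees, and every operator application, assignment and test has unit
  cost. This is realistic because trees can be represented by shared pointers, so that each step
  takes constant time on a pointer machine; polynomial time in this model is the same as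
  polynomial time on Turing machines, provided that the input and output trees are themselves of
  polynomial size, as they are below.\<close>

datatype tree = Leaf | Node tree tree

fun left :: "tree \<Rightarrow> tree" where
  "left Leaf = Leaf"
| "left (Node l r) = l"

fun right :: "tree \<Rightarrow> tree" where
  "right Leaf = Leaf"
| "right (Node l r) = r"

datatype exp = Var nat | Nil_exp | Cons_exp exp exp | Hd_exp exp | Tl_exp exp

type_synonym store = "nat \<Rightarrow> tree"

primrec exp_val :: "exp \<Rightarrow> store \<Rightarrow> tree" where
  "exp_val (Var x) s = s x"
| "exp_val Nil_exp s = Leaf"
| "exp_val (Cons_exp a b) s = Node (exp_val a s) (exp_val b s)"
| "exp_val (Hd_exp a) s = left (exp_val a s)"
| "exp_val (Tl_exp a) s = right (exp_val a s)"

primrec exp_cost :: "exp \<Rightarrow> nat" where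
  "exp_cost (Var x) = 1"
| "exp_cost Nil_exp = 1"
| "exp_cost (Cons_exp a b) = 1 + exp_cost a + exp_cost b"
| "exp_cost (Hd_exp a) = 1 + exp_cost a"
| "exp_cost (Tl_exp a) = 1 + exp_cost a"

datatype com = Assign nat exp | Seq com com | If exp com com | While exp com

text \<open>\<open>exec c s t s'\<close>: started in \<open>s\<close>, the program \<open>c\<close> halts in \<open>s'\<close> after
  \<open>t\<close> steps. A test succeeds if its value is not \<open>Leaf\<close>.\<close>

inductive exec :: "com \<Rightarrow> store \<Rightarrow> nat \<Rightarrow> store \<Rightarrow> bool" where
  Assign: "exec (Assign x a) s (1 + exp_cost a) (s(x := exp_val a s))"
| Seq: "exec c s t s' \<Longrightarrow> exec d s' t' s'' \<Longrightarrow> exec (Seq c d) s (t + t') s''"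
| If_true: "exp_val a s \<noteq> Leaf \<Longrightarrow> exec c s t s' \<Longrightarrow>
    exec (If a c d) s (1 + exp_cost a + t) s'"
| If_false: "exp_val a s = Leaf \<Longrightarrow> exec d s t s' \<Longrightarrow>
    exec (If a c d) s (1 + exp_cost a + t) s'"
| While_false: "exp_val a s = Leaf \<Longrightarrow> exec (While a c) s (1 + exp_cost a) s"
| While_true: "exp_val a s \<noteq> Leaf \<Longrightarrow> exec c s t s' \<Longrightarrow> exec (While a c) s' t' s'' \<Longrightarrow>
    exec (While a c) s (1 + exp_cost a + t + t') s''"

text \<open>Variable 0 holds the input at the start and the output at the end.\<close>

definition computes_within :: "com \<Rightarrow> tree \<Rightarrow> nat \<Rightarrow> tree \<Rightarrow> bool" where
  "computes_within c x b y \<longleftrightarrow>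
     (\<exists>t s. exec c ((\<lambda>_. Leaf)(0 := x)) t s \<and> t \<le> b \<and> s 0 = y)"

text \<open>Problem instances have vertex set \<open>{..<n}\<close> and edge set \<open>{..<m}\<close>. Vertices are
  written in unary, so the encodings have size polynomial in \<open>n + m\<close>.\<close>

primrec enc_nat :: "nat \<Rightarrow> tree" where
  "enc_nat 0 = Leaf"
| "enc_nat (Suc n) = Node Leaf (enc_nat n)"

primrec enc_list :: "('a \<Rightarrow> tree) \<Rightarrow> 'a list \<Rightarrow> tree" where
  "enc_list f [] = Leaf"
| "enc_list f (x # xs) = Node (f x) (enc_list f xs)"

definition enc_pair :: "nat \<times> nat \<Rightarrow> tree" where
  "enc_pair p = Node (enc_nat (fst p)) (enc_nat (snd p))"

definition standard_instance :: "(nat, nat) multigraph \<Rightarrow> bool" where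
  "standard_instance G \<longleftrightarrow> vertices G = {..<card (vertices G)} \<and> edges G = {..<card (edges G)}"

definition enc_graph :: "(nat, nat) multigraph \<Rightarrow> tree" where
  "enc_graph G = Node (enc_nat (card (vertices G)))
     (enc_list (\<lambda>e. enc_pair (Min (ends G e), Max (ends G e))) [0..<card (edges G)])"

definition enc_orientation :: "(nat, nat) pre_digraph \<Rightarrow> tree" where
  "enc_orientation D = enc_list (\<lambda>e. enc_pair (arc_to_ends D e)) [0..<card (arcs D)]"

definition enc_instance ::
    "(nat, nat) multigraph \<Rightarrow> (nat, nat) pre_digraph \<Rightarrow> (nat, nat) pre_digraph \<Rightarrow> tree" where
  "enc_instance G D1 D2 =
     Node (enc_graph G) (Node (enc_orientation D1) (enc_orientation D2))"

definition enc_path :: "(nat, nat) pre_digraph list \<Rightarrow> tree" where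
  "enc_path p = enc_list enc_orientation p"

end

theory Submission
  imports Defs
begin

text \<open>
  Every edge set \<open>diff G D D'\<close> on which two strong orientations disagree has to be flipped, and a
  flip changes one edge only, so the distance is at least the size of this set. No edge of a
  2-edge-cut can ever be flipped alone. Conversely, if no 2-edge-cut lies within the set, then some
  edge in it can be flipped: walk along the segment from a positive circulation of \<open>D\<close> to one of
  \<open>D'\<close>, and flip the first edge whose value vanishes. So the distance equals the size of the set,
  and a shortest path is found greedily: flipping \<open>(u, v)\<close> keeps an orientation strong iff \<open>v\<close>
  can still be reached from \<open>u\<close>.
\<close>

section \<open>Circulations\<close>

text \<open>Read in the directions of \<open>D\<close>, a positive circulation of \<open>D'\<close>
  is negative exactly on the disagreements, so along the segment only these edges can reach zero.
  The obstacle is a tie: if several edges vanish together, flipping one of them may leave a set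
  \<open>S\<close> that no arc leaves. Comparing inflow and outflow of \<open>S\<close> then shows
  that all edges of its cut vanish at the same moment, and a tie-break by the value in
  \<open>D\<close> reduces this cut to exactly two edges, a 2-edge-cut inside the disagreements. For
  the program this means that any flippable disagreement is a good choice. It therefore makes blind
  passes over all edges. A pass that starts with disagreements left makes at least one flip, so as
  many passes as there are edges suffice. Strong connectivity is kept in cut form throughout, and
  reachability enters only as membership in every closed set.\<close>

definition net :: "('v, 'e) pre_digraph \<Rightarrow> ('e \<Rightarrow> int) \<Rightarrow> 'v \<Rightarrow> int" where
  "net D x w = (\<Sum>a\<in>arcs D. x a * (of_bool (tail D a = w) - of_bool (head D a = w)))"

lemma net_add: "net D (\<lambda>a. x a + y a) w = net D x w + net D y w"
  by (simp add: net_def distrib_right sum.distrib)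

lemma net_sum: "net D (\<lambda>a. \<Sum>b\<in>B. x b a) w = (\<Sum>b\<in>B. net D (x b) w)"
  unfolding net_def by (simp add: sum_distrib_right sum.swap[where A = B])

lemma net_unit:
  assumes "finite (arcs D)" "b \<in> arcs D"
  shows "net D (\<lambda>a. of_bool (a = b)) w = of_bool (tail D b = w) - of_bool (head D b = w)"
proof -
  have "net D (\<lambda>a. of_bool (a = b)) w =
      (\<Sum>a\<in>arcs D. if a = b then of_bool (tail D a = w) - of_bool (head D a = w) else 0)"
    unfolding net_def by (rule sum.cong) auto
  then show ?thesis
    using assms by simp
qed

text \<open>An arc with both ends in \<open>S\<close> contributes once with each sign and cancels,
  which leaves outflow minus inflow.\<close>

lemma net_cut:
  assumes "finite S" "finite (arcs D)"
  shows "(\<Sum>w\<in>S. net D x w) = (\<Sum>a\<in>{a \<in> arcs D. tail D a \<in> S \<and> head D a \<notin> S}. x a) -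
    (\<Sum>a\<in>{a \<in> arcs D. head D a \<in> S \<and> tail D a \<notin> S}. x a)"
proof -
  have "(\<Sum>w\<in>S. net D x w) =
      (\<Sum>a\<in>arcs D. x a * (of_bool (tail D a \<in> S) - of_bool (head D a \<in> S)))"
    unfolding net_def using assms(1)
    by (subst sum.swap) (simp add: sum_distrib_left[symmetric] sum_subtractf of_bool_def)
  also have "\<dots> = (\<Sum>a\<in>arcs D. (if tail D a \<in> S \<and> head D a \<notin> S then x a else 0) -
      (if head D a \<in> S \<and> tail D a \<notin> S then x a else 0))"
    by (rule sum.cong) auto
  also have "\<dots> = (\<Sum>a\<in>{a \<in> arcs D. tail D a \<in> S \<and> head D a \<notin> S}. x a) -
      (\<Sum>a\<in>{a \<in> arcs D. head D a \<in> S \<and> tail D a \<notin> S}. x a)"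
    unfolding sum_subtractf using assms(2) by (simp only: sum.inter_filter)
  finally show ?thesis .
qed

text \<open>A unit flow from \<open>u\<close> to \<open>v\<close>, obtained without paths: the
  vertices that admit one form a set containing \<open>u\<close>, and an arc leaving this set would
  extend a flow to its head.\<close>

lemma strong_flow:
  assumes "strong D" "finite (arcs D)" "u \<in> verts D" "v \<in> verts D"
  obtains x where "\<And>a. x a \<ge> 0" "\<And>w. net D x w = of_bool (w = u) - of_bool (w = v)"
proof -
  let ?P = "\<lambda>v x. (\<forall>a. x a \<ge> 0) \<and> (\<forall>w. net D x w = of_bool (w = u) - of_bool (w = v))"
  define S where "S = {v \<in> verts D. \<exists>x. ?P v x}"
  have "?P u (\<lambda>_. 0)"
    by (simp add: net_def)
  then have "\<exists>x. ?P u x"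
    by (intro exI[of _ "\<lambda>_. 0"])
  then have "u \<in> S"
    unfolding S_def using assms(3) by blast
  moreover have False if "S \<subset> verts D"
  proof -
    from that \<open>u \<in> S\<close> \<open>strong D\<close> obtain b
      where b: "b \<in> arcs D" "tail D b \<in> S" "head D b \<in> verts D" "head D b \<notin> S"
      unfolding strong_def by blast
    then obtain x where x: "?P (tail D b) x"
      unfolding S_def by blast
    have "?P (head D b) (\<lambda>a. x a + of_bool (a = b))"
      using x by (auto simp: net_add net_unit[OF assms(2) b(1)])
    then have "\<exists>x. ?P (head D b) x"
      by (intro exI[of _ "\<lambda>a. x a + of_bool (a = b)"])
    then show False
      using b(3,4) unfolding S_def by blast
  qed
  ultimately have "S = verts D"
    unfolding S_def by blast
  then have "\<exists>x. ?P v x"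
    using assms(4) unfolding S_def by blast
  then show thesis
    using that by blast
qed

lemma strong_circulation:
  assumes "strong D" "finite (arcs D)" "\<And>a. a \<in> arcs D \<Longrightarrow> tail D a \<in> verts D \<and> head D a \<in> verts D"
  obtains x where "\<And>a. a \<in> arcs D \<Longrightarrow> x a > 0" "\<And>w. net D x w = 0"
proof -
  have "\<exists>x. (\<forall>a. x a \<ge> 0) \<and>
      (\<forall>w. net D x w = of_bool (w = head D b) - of_bool (w = tail D b))" if b: "b \<in> arcs D" for b
    using strong_flow[OF assms(1,2), of "head D b" "tail D b"] assms(3)[OF b] by metis
  then obtain c where c: "\<And>b a. b \<in> arcs D \<Longrightarrow> c b a \<ge> 0"
    "\<And>b w. b \<in> arcs D \<Longrightarrow> net D (c b) w = of_bool (w = head D b) - of_bool (w = tail D b)"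
    by metis
  \<comment> \<open>One unit on \<open>b\<close> closes up the flow from the head of
    \<open>b\<close> back to its tail; the sum over all \<open>b\<close> is positive on every
    arc.\<close>
  define x where "x = (\<lambda>a. \<Sum>b\<in>arcs D. c b a + of_bool (a = b))"
  have "x a > 0" if "a \<in> arcs D" for a
  proof -
    have "0 < c a a + of_bool (a = a)"
      using c(1)[OF that, of a] by simp
    also have "\<dots> \<le> x a"
      unfolding x_def using that assms(2) c(1)
      by (intro member_le_sum[of a "arcs D" "\<lambda>b. c b a + of_bool (a = b)"]) auto
    finally show ?thesis .
  qed
  moreover have "net D x w = 0" for w
  proof -
    have "net D (\<lambda>a. c b a + of_bool (a = b)) w = 0" if "b \<in> arcs D" for b
      by (simp add: net_add net_unit[OF assms(2) that] c(2)[OF that]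
        eq_commute[of w "head D b"] eq_commute[of w "tail D b"])
    then show ?thesis
      unfolding x_def net_sum by simp
  qed
  ultimately show thesis
    using that by blast
qed

section \<open>Flips of strong orientations\<close>

text \<open>Comparing tails is enough, since both orientations share the two ends of an edge;
  \<open>diff_ends\<close> recovers the heads.\<close>

definition diff :: "('v, 'e) multigraph \<Rightarrow> ('v, 'e) pre_digraph \<Rightarrow> ('v, 'e) pre_digraph \<Rightarrow> 'e set" where
  "diff G D D' = {e \<in> edges G. tail D e \<noteq> tail D' e}"

definition blocked :: "('v, 'e) multigraph \<Rightarrow> ('v, 'e) pre_digraph \<Rightarrow> ('v, 'e) pre_digraph \<Rightarrow> bool" where
  "blocked G D D' \<longleftrightarrow> (\<exists>e f. two_edge_cut G {e, f} \<and> e \<in> diff G D D' \<and> f \<in> diff G D D')"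

lemma finite_diff: "multigraph G \<Longrightarrow> finite (diff G D D')"
  unfolding diff_def multigraph_def by simp

lemma orientationD:
  assumes "multigraph G" "orientation G D"
  shows "verts D = vertices G" "arcs D = edges G" "finite (vertices G)" "finite (edges G)"
    and "e \<in> edges G \<Longrightarrow> ends G e = {tail D e, head D e}"
    and "e \<in> edges G \<Longrightarrow> tail D e \<noteq> head D e"
    and "e \<in> edges G \<Longrightarrow> tail D e \<in> vertices G"
    and "e \<in> edges G \<Longrightarrow> head D e \<in> vertices G"
proof -
  show "verts D = vertices G" "arcs D = edges G" "finite (vertices G)" "finite (edges G)"
    using assms unfolding multigraph_def orientation_def by auto
  show *: "ends G e = {tail D e, head D e}" if "e \<in> edges G" for e
    using assms that unfolding orientation_def by auto
  have "card (ends G e) = 2" "ends G e \<subseteq> vertices G" if "e \<in> edges G" for e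
    using assms that unfolding multigraph_def by auto
  then show "e \<in> edges G \<Longrightarrow> tail D e \<noteq> head D e" "e \<in> edges G \<Longrightarrow> tail D e \<in> vertices G"
    "e \<in> edges G \<Longrightarrow> head D e \<in> vertices G"
    using * by force+
qed

lemma diff_ends:
  assumes "multigraph G" "orientation G D" "orientation G D'" "e \<in> edges G"
  shows "if e \<in> diff G D D' then tail D' e = head D e \<and> head D' e = tail D e
    else tail D' e = tail D e \<and> head D' e = head D e"
  using orientationD(5,6)[OF assms(1,2,4)] orientationD(5,6)[OF assms(1,3,4)] assms(4)
  unfolding diff_def by (auto simp: doubleton_eq_iff)

lemma cut_orientation:
  assumes "multigraph G" "orientation G D"
  shows "cut G S = {a \<in> edges G. tail D a \<in> S \<and> head D a \<notin> S} \<union>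
    {a \<in> edges G. head D a \<in> S \<and> tail D a \<notin> S}"
proof -
  have "card (ends G e \<inter> S) = 1 \<longleftrightarrow> (tail D e \<in> S) \<noteq> (head D e \<in> S)" if "e \<in> edges G" for e
    using orientationD(5,6)[OF assms that] by (auto simp: Int_insert_left card_insert_if)
  then show ?thesis
    unfolding cut_def by auto
qed

lemma flip_simps [simp]:
  "verts (flip e D) = verts D" "arcs (flip e D) = arcs D"
  "tail (flip e D) = (tail D)(e := head D e)" "head (flip e D) = (head D)(e := tail D e)"
  unfolding flip_def by simp_all

lemma flip_flip [simp]: "flip e (flip e D) = D"
  by (rule pre_digraph.equality) (auto simp: fun_eq_iff)

lemma orientation_flip:
  assumes "orientation G D" "e \<in> edges G"
  shows "orientation G (flip e D)"
  using assms unfolding orientation_def by (auto simp: insert_commute)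

lemma orientation_eqI:
  assumes "multigraph G" "orientation G D" "orientation G D'" "diff G D D' = {}"
  shows "D = D'"
proof (rule pre_digraph.equality)
  show "verts D = verts D'" "arcs D = arcs D'"
    using assms unfolding orientation_def by auto
  have "tail D e = tail D' e \<and> head D e = head D' e" for e
  proof (cases "e \<in> edges G")
    case True
    then show ?thesis
      using diff_ends[OF assms(1-3) True] assms(4) by simp
  next
    case False
    then show ?thesis
      using assms(2,3) unfolding orientation_def by simp
  qed
  then show "tail D = tail D'" "head D = head D'"
    by (auto simp: fun_eq_iff)
qed simp

text \<open>An arc entering \<open>S\<close> is one leaving the complement, so a single direction
  suffices.\<close>

lemma strong_iff_leaving:
  assumes "\<And>a. a \<in> arcs D \<Longrightarrow> tail D a \<in> verts D \<and> head D a \<in> verts D"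
  shows "strong D \<longleftrightarrow>
    (\<forall>S. S \<noteq> {} \<and> S \<subset> verts D \<longrightarrow> (\<exists>a \<in> arcs D. tail D a \<in> S \<and> head D a \<notin> S))"
    (is "_ \<longleftrightarrow> ?R")
proof
  show ?R if "strong D"
    using that unfolding strong_def by blast
  assume R: ?R
  show "strong D"
    unfolding strong_def
  proof (intro allI impI conjI)
    fix S assume S: "S \<noteq> {} \<and> S \<subset> verts D"
    show "\<exists>a\<in>arcs D. tail D a \<in> S \<and> head D a \<in> verts D - S"
      using R S assms by (meson DiffI)
    have "verts D - S \<noteq> {} \<and> verts D - S \<subset> verts D"
      using S by auto
    then obtain a where "a \<in> arcs D" "tail D a \<in> verts D - S" "head D a \<notin> verts D - S"
      using R by meson
    then show "\<exists>a\<in>arcs D. tail D a \<in> verts D - S \<and> head D a \<in> S"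
      using assms by blast
  qed
qed

text \<open>A set that no arc leaves after the flip was left by some arc of the strong
  \<open>D\<close>, and this arc can only be \<open>e\<close>. The excluded sets are the witnesses
  that the head of \<open>e\<close> is unreachable from its tail without \<open>e\<close>, which
  turns strength after the flip into a reachability test.\<close>

lemma strong_flip_iff:
  assumes "multigraph G" "orientation G D" "strong D" "e \<in> edges G"
  shows "strong (flip e D) \<longleftrightarrow> \<not> (\<exists>S. S \<subseteq> vertices G \<and> tail D e \<in> S \<and> head D e \<notin> S \<and>
    (\<forall>a \<in> edges G. a \<noteq> e \<longrightarrow> tail D a \<in> S \<longrightarrow> head D a \<in> S))"
proof -
  note D = orientationD[OF assms(1,2)]
  let ?F = "\<lambda>S. S \<noteq> {} \<and> S \<subset> vertices G \<and>
    \<not> (\<exists>a \<in> edges G. tail (flip e D) a \<in> S \<and> head (flip e D) a \<notin> S)"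
  have "strong (flip e D) \<longleftrightarrow> \<not> (\<exists>S. ?F S)"
  proof -
    have "tail (flip e D) a \<in> verts (flip e D) \<and> head (flip e D) a \<in> verts (flip e D)"
      if "a \<in> arcs (flip e D)" for a
      using D(7,8)[of a] D(7,8)[OF assms(4)] that D(1,2) by simp
    from strong_iff_leaving[of "flip e D", OF this] show ?thesis
      unfolding flip_simps(1,2) D(1,2) by blast
  qed
  moreover have iff: "?F S \<longleftrightarrow> S \<subseteq> vertices G \<and> tail D e \<in> S \<and> head D e \<notin> S \<and>
    (\<forall>a \<in> edges G. a \<noteq> e \<longrightarrow> tail D a \<in> S \<longrightarrow> head D a \<in> S)" (is "_ \<longleftrightarrow> ?T S") for S
  proof
    assume T: "?T S"
    then have "S \<noteq> {}" "S \<subset> vertices G"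
      using D(8)[OF assms(4)] by blast+
    moreover have "\<not> (tail (flip e D) a \<in> S \<and> head (flip e D) a \<notin> S)"
      if "a \<in> edges G" for a
      using T that by (cases "a = e") simp_all
    ultimately show "?F S"
      by blast
  next
    assume F: "?F S"
    have *: "head D a \<in> S" if "a \<in> edges G" "a \<noteq> e" "tail D a \<in> S" for a
    proof (rule ccontr)
      assume "head D a \<notin> S"
      then have "tail (flip e D) a \<in> S \<and> head (flip e D) a \<notin> S"
        using that by simp
      then show False
        using F that(1) by blast
    qed
    have "S \<noteq> {} \<and> S \<subset> verts D"
      using F D(1) by simp
    from assms(3)[unfolded strong_def, rule_format, OF this]
    obtain b where b: "b \<in> edges G" "tail D b \<in> S" "head D b \<notin> S"
      using D(2) by blast
    then have "b = e"
      using * by blast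
    then show "?T S"
      using F * b by blast
  qed
  ultimately show ?thesis
    by (simp only: iff)
qed

text \<open>An edge \<open>e\<close> is chosen whose ratio \<open>y e / x e\<close> is maximal, where \<open>x\<close> and \<open>y\<close> are positive
  circulations of the two orientations, and among these one with \<open>x e\<close> minimal. If \<open>e\<close> is the only
  arc that leaves \<open>S\<close>, then balancing \<open>x\<close> and \<open>y\<close> on \<open>S\<close> forces every arc that enters \<open>S\<close> to have
  the same ratio, and minimality leaves room for only one such arc.\<close>

lemma flippable_edge:
  assumes G: "multigraph G" and D: "strong_orientation G D" and D': "strong_orientation G D'"
    and "\<not> blocked G D D'" "diff G D D' \<noteq> {}"
  obtains e where "e \<in> diff G D D'" "strong (flip e D)"
proof -
  let ?X = "diff G D D'"
  have o: "orientation G D" "orientation G D'" and s: "strong D" "strong D'"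
    using D D' unfolding strong_orientation_def by auto
  note oD = orientationD[OF G o(1)] and oD' = orientationD[OF G o(2)]
  obtain x where x: "\<And>a. a \<in> edges G \<Longrightarrow> x a > 0" "\<And>w. net D x w = 0"
    using strong_circulation[OF s(1)] oD(1,2,4,7,8) by metis
  obtain y where y: "\<And>a. a \<in> edges G \<Longrightarrow> y a > 0" "\<And>w. net D' y w = 0"
    using strong_circulation[OF s(2)] oD'(1,2,4,7,8) by metis
  \<comment> \<open>This is \<open>y\<close> read in the directions of \<open>D\<close>; as a
    circulation of \<open>D\<close> it can be combined linearly with \<open>x\<close>.\<close>
  define z where "z a = (if a \<in> ?X then - y a else y a)" for a
  have z: "net D z w = 0" for w
  proof -
    have "net D z w = net D' y w"
      unfolding net_def oD(2) oD'(2)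
    proof (rule sum.cong)
      fix a assume "a \<in> edges G"
      then show "z a * (of_bool (tail D a = w) - of_bool (head D a = w)) =
          y a * (of_bool (tail D' a = w) - of_bool (head D' a = w))"
        using diff_ends[OF G o, of a] by (auto simp: z_def split: if_splits)
    qed simp
    then show ?thesis
      using y(2) by simp
  qed
  \<comment> \<open>On the segment \<open>(1 - t) * x + t * z\<close> an edge of \<open>?X\<close>
    vanishes at \<open>t = x a / (x a + y a)\<close>, so the first to vanish has the largest ratio
    \<open>y a / x a\<close>.\<close>
  define r where "r a = real_of_int (y a) / real_of_int (x a)" for a
  have X: "a \<in> edges G" if "a \<in> ?X" for a
    using that unfolding diff_def by simp
  obtain e0 where e0: "is_arg_min (\<lambda>a. - r a) (\<lambda>a. a \<in> ?X) e0"
    using ex_is_arg_min_if_finite[OF finite_diff[OF G] assms(5)] by blast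
  let ?Y = "{a \<in> ?X. r a = r e0}"
  have "finite ?Y" "?Y \<noteq> {}"
    using finite_diff[OF G] e0 unfolding is_arg_min_def by auto
  from ex_is_arg_min_if_finite[OF this] obtain e where "is_arg_min x (\<lambda>a. a \<in> ?Y) e"
    by blast
  then have e: "e \<in> ?X" and max: "\<And>a. a \<in> ?X \<Longrightarrow> r a \<le> r e"
    and min: "\<And>a. a \<in> ?X \<Longrightarrow> r a = r e \<Longrightarrow> x e \<le> x a"
    using e0 unfolding is_arg_min_def by (auto simp: not_less)
  \<comment> \<open>Both extremal choices with denominators cleared, so that the flow argument stays
    in the integers.\<close>
  have cross: "y a * x e \<le> y e * x a" "y a * x e = y e * x a \<Longrightarrow> x e \<le> x a" if "a \<in> ?X" for a
  proof -
    have pos: "x a > 0" "x e > 0"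
      using x(1) X that e by auto
    have "r a \<le> r e \<longleftrightarrow> real_of_int (y a * x e) \<le> real_of_int (y e * x a)"
      unfolding r_def using pos by (simp add: divide_le_eq le_divide_eq mult.commute)
    then show "y a * x e \<le> y e * x a"
      using max[OF that] by linarith
    have "r a = r e \<longleftrightarrow> real_of_int (y a * x e) = real_of_int (y e * x a)"
      unfolding r_def using pos by (simp add: frac_eq_eq)
    then show "x e \<le> x a" if "y a * x e = y e * x a"
      using min[OF \<open>a \<in> ?X\<close>] that by simp
  qed
  have "strong (flip e D)"
  proof (rule ccontr)
    assume "\<not> strong (flip e D)"
    then obtain S where S: "S \<subseteq> vertices G" "tail D e \<in> S" "head D e \<notin> S"
      "\<And>a. a \<in> edges G \<Longrightarrow> a \<noteq> e \<Longrightarrow> tail D a \<in> S \<Longrightarrow> head D a \<in> S"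
      unfolding strong_flip_iff[OF G o(1) s(1) X[OF e]] by blast
    define I where "I = {a \<in> edges G. head D a \<in> S \<and> tail D a \<notin> S}"
    have out: "{a \<in> edges G. tail D a \<in> S \<and> head D a \<notin> S} = {e}"
      using S X[OF e] by auto
    have fin: "finite S" "finite I"
      using finite_subset[OF S(1) oD(3)] oD(4) unfolding I_def by auto
    \<comment> \<open>As \<open>e\<close> is the only arc leaving \<open>S\<close>, conservation
      equates its value with the total over the entering arcs \<open>I\<close>.\<close>
    have bal: "g e = (\<Sum>a\<in>I. g a)" if "\<And>w. net D g w = 0" for g
      using net_cut[OF fin(1), of D g] that out oD(2,4) unfolding I_def by simp
    \<comment> \<open>The combination \<open>y e * x + x e * z\<close> is a positive multiple of the
      point of the segment at which \<open>e\<close> vanishes. Its sum over \<open>I\<close> is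
      therefore zero, while maximality of the ratio makes every summand nonnegative, so all of
      \<open>I\<close> vanishes there too.\<close>
    have "(\<Sum>a\<in>I. y e * x a + z a * x e) = y e * (\<Sum>a\<in>I. x a) + (\<Sum>a\<in>I. z a) * x e"
      by (simp add: sum.distrib sum_distrib_left sum_distrib_right)
    also have "\<dots> = 0"
    proof -
      have "(\<Sum>a\<in>I. x a) = x e" "(\<Sum>a\<in>I. z a) = - y e"
        using bal[of x, OF x(2)] bal[of z, OF z] e by (simp_all add: z_def)
      then show ?thesis
        by simp
    qed
    finally have sum0: "(\<Sum>a\<in>I. y e * x a + z a * x e) = 0" .
    have pos: "x e > 0" "y e > 0" "\<And>a. a \<in> I \<Longrightarrow> x a > 0 \<and> y a > 0"
      using x(1) y(1) X[OF e] unfolding I_def by auto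
    have "y e * x a + z a * x e \<ge> 0" if "a \<in> I" for a
      using cross(1)[of a] pos(1,2) pos(3)[OF that] by (cases "a \<in> ?X") (auto simp: z_def)
    then have zero: "y e * x a + z a * x e = 0" if "a \<in> I" for a
      using sum0 fin(2) that by (simp add: sum_nonneg_eq_0_iff)
    have IX: "a \<in> ?X" if "a \<in> I" for a
    proof (rule ccontr)
      assume "a \<notin> ?X"
      then show False
        using zero[OF that] mult_pos_pos[of "y e" "x a"] mult_pos_pos[of "y a" "x e"]
          pos(1,2) pos(3)[OF that] unfolding z_def by (smt (verit))
    qed
    have "x e \<le> x a" if "a \<in> I" for a
      using zero[OF that] IX[OF that] cross(2)[OF IX[OF that]] by (simp add: z_def)
    \<comment> \<open>Each entering arc carries at least \<open>x e\<close>, and together they carry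
      exactly \<open>x e\<close>; this leaves room for one.\<close>
    then have "int (card I) * x e \<le> (\<Sum>a\<in>I. x a)"
      using sum_bounded_below[of I "x e" x] by simp
    then have "int (card I) * x e \<le> 1 * x e"
      using bal[of x] x(2) by simp
    then have "card I \<le> 1"
      using pos(1) mult_le_cancel_right[of "int (card I)" "x e" 1] by auto
    moreover have "I \<noteq> {}"
      using bal[of x] x(2) pos(1) by auto
    ultimately have "card I = 1"
      using fin(2) by (metis card_0_eq le_antisym less_one not_less)
    then obtain f where f: "I = {f}"
      by (auto simp: card_1_singleton_iff)
    have "cut G S = {e, f}"
      using cut_orientation[OF G o(1), of S] out f unfolding I_def by auto
    moreover have "e \<noteq> f"
      using f S(2) unfolding I_def by auto
    ultimately have "two_edge_cut G {e, f}"
      unfolding two_edge_cut_def using S(1) by (intro exI[of _ S]) auto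
    then show False
      using assms(4) e IX[of f] f unfolding blocked_def by blast
  qed
  then show thesis
    using that e by blast
qed

section \<open>Paths in the edge-flip graph\<close>

lemma strong_orientationD:
  "strong_orientation G D \<Longrightarrow> orientation G D" "strong_orientation G D \<Longrightarrow> strong D"
  unfolding strong_orientation_def by auto

lemma edge_flip_arcs:
  "(D, D') \<in> parcs (edge_flip_graph G) \<longleftrightarrow> strong_orientation G D \<and> strong_orientation G D' \<and>
    (\<exists>e \<in> edges G. D' = flip e D)"
  unfolding edge_flip_graph_def by (auto intro: flip_flip[symmetric])

lemma edge_flip_verts: "pverts (edge_flip_graph G) = {D. strong_orientation G D}"
  unfolding edge_flip_graph_def by simp

section \<open>Lower bound for walks, and the obstruction by 2-edge-cuts\<close>

lemma diff_flip_subset: "diff G D D' \<subseteq> insert e (diff G (flip e D) D')"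
  unfolding diff_def by auto

lemma flip_walk_length:
  assumes "multigraph G" "vwalk p (with_proj (edge_flip_graph G))"
  shows "card (diff G (hd p) (last p)) \<le> vwalk_length p"
  using assms(2)
\<comment> \<open>The rule serves for its split into empty, one-vertex and longer walks.\<close>
proof (induction p rule: vwalk_arcs.induct)
  case (3 D D' p)
  then obtain e where e: "D' = flip e D"
    unfolding vwalk_def by (auto simp: edge_flip_arcs)
  have "vwalk (D' # p) (with_proj (edge_flip_graph G))"
    using "3.prems" unfolding vwalk_def by auto
  then have IH: "card (diff G D' (last (D' # p))) \<le> length p"
    using "3.IH" by simp
  have "card (diff G D (last (D' # p))) \<le> card (insert e (diff G D' (last (D' # p))))"
    using diff_flip_subset[of G D "last (D' # p)" e] finite_diff[OF assms(1)] unfolding e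
    by (intro card_mono) auto
  also have "\<dots> \<le> Suc (length p)"
    using IH finite_diff[OF assms(1)] by (simp add: card_insert_if)
  finally show ?case
    by simp
qed (auto simp: vwalk_def diff_def)

text \<open>A strong orientation directs the two edges of a 2-edge-cut oppositely across
  \<open>S\<close>. Flipping one of them alone would direct both the same way, so \<open>g\<close>
  cannot be \<open>e\<close>.\<close>

lemma flip_preserves_two_edge_cut:
  assumes G: "multigraph G" and D: "strong_orientation G D" "strong_orientation G (flip g D)"
    and "g \<in> edges G" "two_edge_cut G {e, f}"
  shows "tail (flip g D) e = tail D e"
proof (cases "g = e")
  case True
  obtain S where S: "S \<subseteq> vertices G" "cut G S = {e, f}" "card {e, f} = 2"
    using assms(5) unfolding two_edge_cut_def by auto
  have o: "orientation G D'" "strong D'" if "D' \<in> {D, flip g D}" for D'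
    using D that strong_orientationD by auto
  note oD = orientationD[OF G o(1)[of D]]
  have "e \<noteq> f"
    using S(3) by auto
  have "e \<in> cut G S"
    using S(2) by simp
  then have "S \<noteq> {}" "S \<noteq> vertices G"
    using oD(7,8)[of e] cut_orientation[OF G o(1)[of D], of S] by auto
  have *: "(\<exists>a \<in> {e, f}. tail D' a \<in> S \<and> head D' a \<notin> S) \<and>
      (\<exists>a \<in> {e, f}. head D' a \<in> S \<and> tail D' a \<notin> S)" if D': "D' \<in> {D, flip g D}" for D'
  proof -
    have "S \<noteq> {} \<and> S \<subset> verts D'" "arcs D' = edges G"
      using orientationD(1,2)[OF G o(1)[OF D']] \<open>S \<noteq> {}\<close> \<open>S \<noteq> vertices G\<close> S(1) by auto
    with o(2)[OF D', unfolded strong_def, rule_format, of S] show ?thesis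
      unfolding S(2)[symmetric] cut_orientation[OF G o(1)[OF D']] by blast
  qed
  show ?thesis
    using *[of D] *[of "flip g D"] \<open>e \<noteq> f\<close> True by auto
qed simp

lemma flip_walk_preserves_two_edge_cut:
  assumes "multigraph G" "two_edge_cut G {e, f}" "vwalk p (with_proj (edge_flip_graph G))"
  shows "tail (last p) e = tail (hd p) e"
  using assms(3)
proof (induction p rule: vwalk_arcs.induct)
  case (3 D D' p)
  then have "vwalk (D' # p) (with_proj (edge_flip_graph G))"
    unfolding vwalk_def by auto
  then have "tail (last (D' # p)) e = tail D' e"
    using "3.IH" by simp
  moreover have "(D, D') \<in> parcs (edge_flip_graph G)"
    using "3.prems" unfolding vwalk_def by auto
  then have "tail D' e = tail D e"
    using flip_preserves_two_edge_cut[OF assms(1) _ _ _ assms(2)] unfolding edge_flip_arcs by auto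
  ultimately show ?case
    by simp
qed (auto simp: vwalk_def)

lemma flip_path_not_blocked:
  assumes "multigraph G" "flip_path G D p D'"
  shows "\<not> blocked G D D'"
proof
  assume "blocked G D D'"
  then obtain e f where "two_edge_cut G {e, f}" "tail D e \<noteq> tail D' e"
    unfolding blocked_def diff_def by auto
  then show False
    using flip_walk_preserves_two_edge_cut[OF assms(1)] assms(2)
    unfolding flip_path_def vpath_def by metis
qed

text \<open>The last conjunct is carried along for distinctness: a new first vertex that is farther
  from \<open>D'\<close> than \<open>D\<close> cannot already occur on \<open>p\<close>.\<close>

definition geodesic ::
    "('v, 'e) multigraph \<Rightarrow> ('v, 'e) pre_digraph \<Rightarrow> ('v, 'e) pre_digraph list \<Rightarrow>
     ('v, 'e) pre_digraph \<Rightarrow> bool" where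
  "geodesic G D p D' \<longleftrightarrow> flip_path G D p D' \<and> vwalk_length p = card (diff G D D') \<and>
     (\<forall>q \<in> set p. card (diff G q D') \<le> card (diff G D D'))"

lemma geodesic_shortest:
  assumes "multigraph G" "geodesic G D p D'"
  shows "shortest_flip_path G D p D'"
  using assms flip_walk_length[OF assms(1)]
  unfolding shortest_flip_path_def geodesic_def flip_path_def vpath_def by metis

lemma geodesic_flip:
  assumes G: "multigraph G" and p: "geodesic G D p D'"
    and e: "e \<in> edges G" "e \<notin> diff G D D'" "strong_orientation G (flip e D)"
  shows "geodesic G (flip e D) (flip e D # p) D'"
proof -
  have path: "vwalk p (with_proj (edge_flip_graph G))" "distinct p" "hd p = D" "last p = D'" "p \<noteq> []"
    using p unfolding geodesic_def flip_path_def vpath_def vwalk_def by auto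
  then have D: "strong_orientation G D" "strong_orientation G D'"
    unfolding vwalk_def edge_flip_verts with_proj_simps
    by (metis (no_types) hd_in_set last_in_set mem_Collect_eq subsetD)+
  note o = strong_orientationD(1)[OF D(1)] strong_orientationD(1)[OF D(2)]
  have "tail (flip e D) e \<noteq> tail D' e"
    using diff_ends[OF G o e(1)] e(2) orientationD(6)[OF G o(1) e(1)] by auto
  then have "diff G (flip e D) D' = insert e (diff G D D')"
    using e(1) unfolding diff_def by auto
  then have card: "card (diff G (flip e D) D') = Suc (card (diff G D D'))"
    using e(2) finite_diff[OF G] by simp
  have "flip e D \<notin> set p"
    using p card unfolding geodesic_def by (metis Suc_n_not_le_n)
  moreover have "(flip e D, hd p) \<in> parcs (edge_flip_graph G)"
    unfolding edge_flip_arcs path(3) using D(1) e(1,3) by (intro conjI bexI[of _ e]) auto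
  then have "vwalk (flip e D # p) (with_proj (edge_flip_graph G))"
    using path(1) e(3) by (intro vwalk_consI) (auto simp: edge_flip_verts)
  moreover have "vwalk_length (flip e D # p) = Suc (vwalk_length p)"
    using path(5) by (cases p) auto
  ultimately show ?thesis
    using p path card unfolding geodesic_def flip_path_def vpath_def
    by (auto intro: le_SucI simp del: vwalk_length_simp)
qed

text \<open>A path is built backwards from \<open>D2\<close>; its current first vertex \<open>D\<close> agrees on every
  edge with \<open>D1\<close> or with \<open>D2\<close>.\<close>

definition progress ::
    "('v, 'e) multigraph \<Rightarrow> ('v, 'e) pre_digraph \<Rightarrow> ('v, 'e) pre_digraph \<Rightarrow>
     ('v, 'e) pre_digraph \<Rightarrow> ('v, 'e) pre_digraph list \<Rightarrow> bool" where
  "progress G D1 D2 D p \<longleftrightarrow> strong_orientation G D \<and> geodesic G D p D2 \<and>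
     diff G D D1 \<inter> diff G D D2 = {}"

lemma progress_start:
  "strong_orientation G D2 \<Longrightarrow> progress G D1 D2 D2 [D2]"
  unfolding progress_def geodesic_def flip_path_def vpath_def vwalk_def edge_flip_verts
  by (auto simp: diff_def edge_flip_verts)

text \<open>By disjointness the flipped edge agrees with \<open>D2\<close>, so the flip moves one
  step away from \<open>D2\<close> and one step towards \<open>D1\<close>.\<close>

lemma progress_flip:
  assumes "multigraph G" "strong_orientation G D1" "progress G D1 D2 D p"
    and "e \<in> diff G D D1" "strong (flip e D)"
  shows "progress G D1 D2 (flip e D) (flip e D # p)"
    and "card (diff G (flip e D) D1) < card (diff G D D1)"
proof -
  have D: "strong_orientation G D" and p: "geodesic G D p D2" and "diff G D D1 \<inter> diff G D D2 = {}"
    using assms(3) unfolding progress_def by auto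
  note o = strong_orientationD(1)[OF D] strong_orientationD(1)[OF assms(2)]
  have e: "e \<in> edges G" "e \<notin> diff G D D2"
    using assms(4) \<open>diff G D D1 \<inter> diff G D D2 = {}\<close> unfolding diff_def by auto
  have F: "strong_orientation G (flip e D)"
    using orientation_flip[OF o(1) e(1)] assms(5) unfolding strong_orientation_def by simp
  have sub: "diff G (flip e D) D1 = diff G D D1 - {e}"
    using diff_ends[OF assms(1) o e(1)] assms(4) unfolding diff_def by auto
  have "diff G (flip e D) D1 \<inter> diff G (flip e D) D2 = {}"
    using \<open>diff G D D1 \<inter> diff G D D2 = {}\<close> unfolding sub unfolding diff_def by auto
  then show "progress G D1 D2 (flip e D) (flip e D # p)"
    using F geodesic_flip[OF assms(1) p e F] unfolding progress_def by simp
  show "card (diff G (flip e D) D1) < card (diff G D D1)"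
    unfolding sub using assms(4) finite_diff[OF assms(1)] by (rule card_Diff1_less[rotated])
qed

text \<open>This is why the greedy choice never gets stuck. Where \<open>D\<close> disagrees with
  \<open>D1\<close> it agrees with \<open>D2\<close>, so a cut that blocks \<open>D\<close> and
  \<open>D1\<close> would also block \<open>D1\<close> and \<open>D2\<close>.\<close>

lemma progress_flippable:
  assumes "multigraph G" "strong_orientation G D1" "\<not> blocked G D1 D2"
    and "progress G D1 D2 D p" "diff G D D1 \<noteq> {}"
  obtains e where "e \<in> diff G D D1" "strong (flip e D)"
proof -
  have "diff G D D1 \<subseteq> diff G D1 D2"
    using assms(4) unfolding progress_def diff_def by auto
  then have "\<not> blocked G D D1"
    using assms(3) unfolding blocked_def by blast
  then show thesis
    using flippable_edge[OF assms(1) _ assms(2) _ assms(5)] assms(4) that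
    unfolding progress_def by blast
qed

lemma progress_finish:
  assumes "multigraph G" "strong_orientation G D1" "progress G D1 D2 D p" "diff G D D1 = {}"
  shows "shortest_flip_path G D1 p D2"
proof -
  have "D = D1"
    using assms(2-4) unfolding progress_def
    by (intro orientation_eqI[OF assms(1)] strong_orientationD(1)) auto
  then show ?thesis
    using assms(3) geodesic_shortest[OF assms(1)] unfolding progress_def by blast
qed

lemma flip_path_exists:
  assumes "multigraph G" "strong_orientation G D1" "strong_orientation G D2" "\<not> blocked G D1 D2"
  shows "\<exists>p. flip_path G D1 p D2"
proof -
  have "\<exists>p. flip_path G D1 p D2" if "progress G D1 D2 D p" for D p
    using that
  proof (induction "card (diff G D D1)" arbitrary: D p rule: less_induct)
    case less
    show ?case
    proof (cases "diff G D D1 = {}")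
      case True
      then show ?thesis
        using progress_finish[OF assms(1,2) less.prems] unfolding shortest_flip_path_def by blast
    next
      case False
      then obtain e where "e \<in> diff G D D1" "strong (flip e D)"
        using progress_flippable[OF assms(1,2,4) less.prems] by blast
      then show ?thesis
        using less.hyps progress_flip[OF assms(1,2) less.prems] by blast
    qed
  qed
  then show ?thesis
    using progress_start[OF assms(3)] by blast
qed

lemma blocked_iff_reversed_cut:
  assumes "multigraph G" "orientation G D1" "orientation G D2"
  shows "blocked G D1 D2 \<longleftrightarrow> (\<exists>e f u v u' v'. two_edge_cut G {e, f} \<and>
    arc_to_ends D1 e = (u, v) \<and> arc_to_ends D1 f = (v', u') \<and>
    arc_to_ends D2 e = (v, u) \<and> arc_to_ends D2 f = (u', v'))"
proof -
  have rev: "tail D2 e = head D1 e \<and> head D2 e = tail D1 e \<longleftrightarrow> e \<in> diff G D1 D2"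
    if "e \<in> edges G" for e
    using diff_ends[OF assms that] orientationD(6)[OF assms(1,2) that] by (auto split: if_splits)
  have "e \<in> edges G \<and> f \<in> edges G" if "two_edge_cut G {e, f}" for e f
    using that unfolding two_edge_cut_def cut_def by blast
  then have "blocked G D1 D2 \<longleftrightarrow> (\<exists>e f. two_edge_cut G {e, f} \<and>
      (tail D2 e = head D1 e \<and> head D2 e = tail D1 e) \<and> (tail D2 f = head D1 f \<and> head D2 f = tail D1 f))"
    unfolding blocked_def using rev by blast
  then show ?thesis
    unfolding arc_to_ends_def by auto
qed

section \<open>A Hoare logic with running time\<close>

text \<open>The budget \<open>b\<close> is only an upper bound on the time, so it can be rounded up
  freely and chosen independently of the branch taken.\<close>

definition tot :: "com \<Rightarrow> store \<Rightarrow> nat \<Rightarrow> (store \<Rightarrow> bool) \<Rightarrow> bool" where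
  "tot c s b Q \<longleftrightarrow> (\<exists>t s'. exec c s t s' \<and> t \<le> b \<and> Q s')"

lemma tot_conseq: "tot c s b Q \<Longrightarrow> b \<le> b' \<Longrightarrow> (\<And>s'. Q s' \<Longrightarrow> Q' s') \<Longrightarrow> tot c s b' Q'"
  unfolding tot_def by (meson le_trans)

lemma tot_weaken: "tot c s b Q \<Longrightarrow> b \<le> b' \<Longrightarrow> tot c s b' Q"
  by (rule tot_conseq)

lemma tot_post: "tot c s b Q \<Longrightarrow> (\<And>s'. Q s' \<Longrightarrow> Q' s') \<Longrightarrow> tot c s b Q'"
  by (rule tot_conseq[OF _ le_refl])

inductive_cases Assign_elim: "exec (Assign x a) s t s'"
  and Seq_elim: "exec (Seq c d) s t s'"
  and If_elim: "exec (If a c d) s t s'"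
  and While_elim: "exec (While a c) s t s'"

lemma exec_Assign_iff: "exec (Assign x a) s t s' \<longleftrightarrow> t = 1 + exp_cost a \<and> s' = s(x := exp_val a s)"
  by (auto elim: Assign_elim intro: exec.Assign[simplified])

lemma exec_Seq_iff:
  "exec (Seq c d) s t s'' \<longleftrightarrow> (\<exists>t1 t2 s'. t = t1 + t2 \<and> exec c s t1 s' \<and> exec d s' t2 s'')"
  by (blast elim: Seq_elim intro: exec.Seq)

lemma exec_If_iff:
  "exec (If a c d) s t s' \<longleftrightarrow>
    (\<exists>t1. t = 1 + exp_cost a + t1 \<and> exec (if exp_val a s = Leaf then d else c) s t1 s')"
proof (cases "exp_val a s = Leaf")
  case True
  then show ?thesis
    by (auto elim: If_elim intro: exec.If_false[simplified])
next
  case False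
  then show ?thesis
    by (auto elim: If_elim intro: exec.If_true[simplified])
qed

lemma exec_While_iff:
  "exec (While a c) s t s' \<longleftrightarrow> (if exp_val a s = Leaf then t = 1 + exp_cost a \<and> s' = s
    else \<exists>t1. t = 1 + exp_cost a + t1 \<and> exec (Seq c (While a c)) s t1 s')"
proof (cases "exp_val a s = Leaf")
  case True
  then show ?thesis
    by (auto elim: While_elim intro: exec.While_false[simplified])
next
  case False
  have "exec (While a c) s t s' \<longleftrightarrow> (\<exists>t1 t2 s''. t = 1 + exp_cost a + t1 + t2 \<and>
      exec c s t1 s'' \<and> exec (While a c) s'' t2 s')"
  proof
    assume "exec (While a c) s t s'"
    then show "\<exists>t1 t2 s''. t = 1 + exp_cost a + t1 + t2 \<and>
        exec c s t1 s'' \<and> exec (While a c) s'' t2 s'"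
      by (rule While_elim) (use False in \<open>force simp: add.assoc\<close>)+
  qed (use False exec.While_true in blast)
  then show ?thesis
    unfolding if_not_P[OF False] exec_Seq_iff by (metis add.assoc)
qed

lemma tot_Assign_iff:
  "tot (Assign x a) s b Q \<longleftrightarrow> 1 + exp_cost a \<le> b \<and> Q (s(x := exp_val a s))"
  unfolding tot_def exec_Assign_iff by blast

lemma tot_Seq: "tot c s b (\<lambda>s'. tot d s' b' Q) \<Longrightarrow> tot (Seq c d) s (b + b') Q"
  unfolding tot_def exec_Seq_iff by (blast intro: add_mono)

text \<open>Charging \<open>k\<close> steps before a run amounts to having \<open>k\<close> less to
  spend; \<open>k \<le> b\<close> guards the truncated subtraction.\<close>

lemma tot_delay:
  "(\<exists>t s'. (\<exists>t1. t = k + t1 \<and> exec c s t1 s') \<and> t \<le> b \<and> Q s') \<longleftrightarrow> k \<le> b \<and> tot c s (b - k) Q"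
proof
  assume "k \<le> b \<and> tot c s (b - k) Q"
  then obtain t s' where "k \<le> b" "exec c s t s'" "t \<le> b - k" "Q s'"
    unfolding tot_def by blast
  then show "\<exists>t s'. (\<exists>t1. t = k + t1 \<and> exec c s t1 s') \<and> t \<le> b \<and> Q s'"
    by (intro exI[of _ "k + t"] exI[of _ s']) auto
next
  assume "\<exists>t s'. (\<exists>t1. t = k + t1 \<and> exec c s t1 s') \<and> t \<le> b \<and> Q s'"
  then obtain t s' where "exec c s t s'" "k + t \<le> b" "Q s'"
    by blast
  then show "k \<le> b \<and> tot c s (b - k) Q"
    unfolding tot_def by (intro conjI exI[of _ t] exI[of _ s']) auto
qed

lemma tot_Seq_Assign_iff:
  "tot (Seq (Assign x a) d) s b Q \<longleftrightarrow>
    1 + exp_cost a \<le> b \<and> tot d (s(x := exp_val a s)) (b - (1 + exp_cost a)) Q"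
  unfolding tot_delay[symmetric] unfolding tot_def exec_Seq_iff exec_Assign_iff by blast

lemma tot_If_iff:
  "tot (If a c d) s b Q \<longleftrightarrow> 1 + exp_cost a \<le> b \<and>
    tot (if exp_val a s = Leaf then d else c) s (b - (1 + exp_cost a)) Q"
  unfolding tot_delay[symmetric] unfolding tot_def exec_If_iff by blast

lemma tot_Seq_If_iff:
  "tot (Seq (If a c d) e) s b Q \<longleftrightarrow> 1 + exp_cost a \<le> b \<and>
    tot (Seq (if exp_val a s = Leaf then d else c) e) s (b - (1 + exp_cost a)) Q"
proof -
  have "exec (Seq (If a c d) e) s t s' \<longleftrightarrow>
      (\<exists>t1. t = 1 + exp_cost a + t1 \<and> exec (Seq (if exp_val a s = Leaf then d else c) e) s t1 s')" for t s'
  proof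
    assume "exec (Seq (If a c d) e) s t s'"
    then obtain t1 t2 s1 where "t = 1 + exp_cost a + (t1 + t2)"
      "exec (if exp_val a s = Leaf then d else c) s t1 s1" "exec e s1 t2 s'"
      unfolding exec_Seq_iff exec_If_iff by (metis (no_types) add.assoc)
    then show "\<exists>t1. t = 1 + exp_cost a + t1 \<and>
        exec (Seq (if exp_val a s = Leaf then d else c) e) s t1 s'"
      unfolding exec_Seq_iff by blast
  next
    assume "\<exists>t1. t = 1 + exp_cost a + t1 \<and>
        exec (Seq (if exp_val a s = Leaf then d else c) e) s t1 s'"
    then obtain t1 t2 s1 where "t = (1 + exp_cost a + t1) + t2"
      "exec (if exp_val a s = Leaf then d else c) s t1 s1" "exec e s1 t2 s'"
      unfolding exec_Seq_iff by (metis (no_types) add.assoc)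
    then show "exec (Seq (If a c d) e) s t s'"
      unfolding exec_Seq_iff exec_If_iff by blast
  qed
  then show ?thesis
    unfolding tot_delay[symmetric] unfolding tot_def by simp
qed

lemma tot_Seq_Seq_iff: "tot (Seq (Seq c d) e) s b Q \<longleftrightarrow> tot (Seq c (Seq d e)) s b Q"
proof -
  have "exec (Seq (Seq c d) e) s t s' \<longleftrightarrow> exec (Seq c (Seq d e)) s t s'" for t s'
  proof
    assume "exec (Seq (Seq c d) e) s t s'"
    then obtain t1 t2 t3 s1 s2 where "t = t1 + (t2 + t3)"
      "exec c s t1 s1" "exec d s1 t2 s2" "exec e s2 t3 s'"
      unfolding exec_Seq_iff by (metis (no_types) add.assoc)
    then show "exec (Seq c (Seq d e)) s t s'"
      unfolding exec_Seq_iff by blast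
  next
    assume "exec (Seq c (Seq d e)) s t s'"
    then obtain t1 t2 t3 s1 s2 where "t = (t1 + t2) + t3"
      "exec c s t1 s1" "exec d s1 t2 s2" "exec e s2 t3 s'"
      unfolding exec_Seq_iff by (metis (no_types) add.assoc)
    then show "exec (Seq (Seq c d) e) s t s'"
      unfolding exec_Seq_iff by blast
  qed
  then show ?thesis
    unfolding tot_def by simp
qed

lemma tot_While_iff:
  "tot (While a c) s b Q \<longleftrightarrow> 1 + exp_cost a \<le> b \<and>
    (if exp_val a s = Leaf then Q s else tot (Seq c (While a c)) s (b - (1 + exp_cost a)) Q)"
proof (cases "exp_val a s = Leaf")
  case True
  then show ?thesis
    unfolding tot_def exec_While_iff by auto
next
  case False
  then show ?thesis
    unfolding if_not_P[OF False] tot_delay[symmetric]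
    unfolding tot_def exec_While_iff[of a c] if_not_P[OF False] by blast
qed

text \<open>As rewrite rules these execute loop-free code symbolically from the front and deduct
  each cost from the budget; reassociating to the right exposes the next command.\<close>

lemmas tot_simps = tot_Assign_iff tot_Seq_Assign_iff tot_If_iff tot_Seq_If_iff tot_Seq_Seq_iff

lemma tot_Assign: "Q (s(x := exp_val a s)) \<Longrightarrow> tot (Assign x a) s (1 + exp_cost a) Q"
  by (simp add: tot_Assign_iff)

text \<open>The index of \<open>P\<close> counts the iterations left. \<open>Suc k\<close> in place
  of \<open>k\<close> pays for the final, failing test.\<close>

lemma tot_While:
  assumes "P k s"
    and "\<And>k s. P (Suc k) s \<Longrightarrow> exp_val a s \<noteq> Leaf \<and> tot c s b (P k)"
    and "\<And>s. P 0 s \<Longrightarrow> exp_val a s = Leaf"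
  shows "tot (While a c) s (Suc k * (1 + exp_cost a + b)) (P 0)"
  using assms(1)
proof (induction k arbitrary: s)
  case 0
  then show ?case
    using assms(3)[OF 0] by (subst tot_While_iff) simp
next
  case (Suc k)
  have "tot (Seq c (While a c)) s (b + Suc k * (1 + exp_cost a + b)) (P 0)"
    using assms(2)[OF Suc.prems] Suc.IH by (blast intro: tot_Seq tot_post)
  then show ?case
    using assms(2)[OF Suc.prems] by (subst tot_While_iff) (simp add: algebra_simps)
qed

text \<open>The language has no empty command; this self-assignment takes two steps and changes
  nothing.\<close>

abbreviation Skip :: com where
  "Skip \<equiv> Assign 0 (Var 0)"

text \<open>The loop variable holds the unprocessed suffix, so the suffix length is the iteration
  count of \<open>tot_While\<close>, and the body has to drop the head itself. The 2 in
  \<open>2 + b\<close> is the price of testing a variable.\<close>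

lemma tot_foreach:
  assumes "s x = enc_list f xs" "P xs s" "length xs \<le> n"
    and "\<And>y ys s. s x = Node (f y) (enc_list f ys) \<Longrightarrow> P (y # ys) s \<Longrightarrow>
      tot c s b (\<lambda>s'. s' x = enc_list f ys \<and> P ys s')"
  shows "tot (While (Var x) c) s (Suc n * (2 + b)) (\<lambda>s'. s' x = Leaf \<and> P [] s')"
proof -
  let ?P = "\<lambda>k s. \<exists>ys. length ys = k \<and> s x = enc_list f ys \<and> P ys s"
  have "tot (While (Var x) c) s (Suc (length xs) * (1 + exp_cost (Var x) + b)) (?P 0)"
  proof (rule tot_While)
    show "?P (length xs) s"
      using assms(1,2) by blast
    fix k s assume "?P (Suc k) s"
    then obtain y ys where *: "length ys = k" "s x = Node (f y) (enc_list f ys)" "P (y # ys) s"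
      by (auto simp: length_Suc_conv)
    have "tot c s b (?P k)"
      using assms(4)[OF *(2,3)] by (rule tot_conseq) (use *(1) in auto)
    then show "exp_val (Var x) s \<noteq> Leaf \<and> tot c s b (?P k)"
      using *(2) by simp
  qed auto
  moreover have "Suc (length xs) * (1 + exp_cost (Var x) + b) \<le> Suc n * (2 + b)"
    using assms(3) by (intro mult_le_mono) auto
  ultimately show ?thesis
    by (rule tot_conseq) auto
qed

lemma enc_nat_eq_Leaf [simp]: "enc_nat n = Leaf \<longleftrightarrow> n = 0"
  by (cases n) auto

section \<open>The program\<close>

text \<open>The path is built from its end \<open>D2\<close> towards \<open>D1\<close>, so that each new orientation is consed
  onto the output. Suffixes of the encoding of \<open>D1\<close> serve as loop counters and as edge indices.\<close>

abbreviation (input) "vcur \<equiv> 1 :: nat"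
abbreviation (input) "vgoal \<equiv> 2 :: nat"
abbreviation (input) "vout \<equiv> 3 :: nat"
abbreviation (input) "vouter \<equiv> 4 :: nat"
abbreviation (input) "vinner \<equiv> 5 :: nat"
abbreviation (input) "vi \<equiv> 6 :: nat"
abbreviation (input) "vpre \<equiv> 7 :: nat"
abbreviation (input) "vsuf \<equiv> 8 :: nat"
abbreviation (input) "vh \<equiv> 9 :: nat"
abbreviation (input) "va \<equiv> 10 :: nat"
abbreviation (input) "vb \<equiv> 11 :: nat"
abbreviation (input) "vx \<equiv> 12 :: nat"
abbreviation (input) "vy \<equiv> 13 :: nat"
abbreviation (input) "vcand \<equiv> 14 :: nat"
abbreviation (input) "vrounds \<equiv> 15 :: nat"
abbreviation (input) "varcs \<equiv> 16 :: nat"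
abbreviation (input) "vR \<equiv> 17 :: nat"
abbreviation (input) "vscan \<equiv> 18 :: nat"
abbreviation (input) "vflag \<equiv> 19 :: nat"
abbreviation (input) "vz \<equiv> 20 :: nat"

abbreviation "true_exp \<equiv> Cons_exp Nil_exp Nil_exp"

text \<open>Both unary numbers are counted down together and the answer is left in
  \<open>vy\<close>: \<open>Leaf\<close> for equality, otherwise the surplus of \<open>vy\<close>
  or, if \<open>vx\<close> is the larger, a marker; \<open>vx\<close> is then cleared to end the
  loop.\<close>

definition eq_com :: com where
  "eq_com = While (Var vx)
     (If (Var vy) (Seq (Assign vx (Tl_exp (Var vx))) (Assign vy (Tl_exp (Var vy))))
       (Seq (Assign vx Nil_exp) (Assign vy true_exp)))"

definition mem_com :: com where
  "mem_com = Seq (Assign vflag Nil_exp) (Seq (Assign vscan (Var vR))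
     (While (Var vscan)
       (Seq (Assign vx (Hd_exp (Var vscan))) (Seq (Assign vy (Var vz)) (Seq eq_com
         (Seq (If (Var vy) Skip (Assign vflag true_exp)) (Assign vscan (Tl_exp (Var vscan)))))))))"

text \<open>Heads are consed onto \<open>vR\<close> without a check for duplicates; the list still
  grows by at most one entry per arc.\<close>

definition step_com :: com where
  "step_com = Seq (Assign varcs (Var vcand)) (While (Var varcs)
     (Seq (Assign vz (Hd_exp (Hd_exp (Var varcs)))) (Seq mem_com
       (Seq (If (Var vflag) (Assign vR (Cons_exp (Tl_exp (Hd_exp (Var varcs))) (Var vR))) Skip)
         (Assign varcs (Tl_exp (Var varcs)))))))"

text \<open>Here \<open>vgoal\<close> acts as a counter, giving one sweep per edge.\<close>

definition reach_com :: com where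
  "reach_com = Seq (Assign vR (Cons_exp (Var va) Nil_exp)) (Seq (Assign vrounds (Var vgoal))
     (Seq (While (Var vrounds) (Seq step_com (Assign vrounds (Tl_exp (Var vrounds)))))
       (Seq (Assign vz (Var vb)) mem_com)))"

text \<open>The length of \<open>vinner\<close> is the index of the edge under test. The prefix
  before it comes out reversed, and \<open>join_com\<close> turns it round again.\<close>

definition split_com :: com where
  "split_com = Seq (Assign vi (Var vinner)) (Seq (Assign vpre Nil_exp)
     (Seq (Assign vsuf (Var vcur)) (Seq (Assign vh (Var vgoal))
       (While (Var vi) (Seq (Assign vpre (Cons_exp (Hd_exp (Var vsuf)) (Var vpre)))
         (Seq (Assign vsuf (Tl_exp (Var vsuf))) (Seq (Assign vh (Tl_exp (Var vh)))
           (Assign vi (Tl_exp (Var vi))))))))))"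

definition join_com :: com where
  "join_com = Seq (Assign vcand (Cons_exp (Cons_exp (Var vb) (Var va)) (Tl_exp (Var vsuf))))
     (While (Var vpre) (Seq (Assign vcand (Cons_exp (Hd_exp (Var vpre)) (Var vcand)))
       (Assign vpre (Tl_exp (Var vpre)))))"

definition try_com :: com where
  "try_com = Seq split_com (Seq (Assign va (Hd_exp (Hd_exp (Var vsuf))))
     (Seq (Assign vb (Tl_exp (Hd_exp (Var vsuf))))
     (Seq (Assign vx (Hd_exp (Hd_exp (Var vh)))) (Seq (Assign vy (Var va)) (Seq eq_com
       (If (Var vy) (Seq join_com (Seq reach_com
         (If (Var vflag) (Seq (Assign vcur (Var vcand)) (Assign vout (Cons_exp (Var vcand) (Var vout))))
           Skip))) Skip))))))"

text \<open>Shortening \<open>vinner\<close> before each test makes the tested indices run from the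
  last edge down to 0.\<close>

definition pass_com :: com where
  "pass_com = Seq (Assign vinner (Var vgoal))
     (While (Var vinner) (Seq (Assign vinner (Tl_exp (Var vinner))) try_com))"

definition main_com :: com where
  "main_com = Seq (Assign vgoal (Hd_exp (Tl_exp (Var 0)))) (Seq (Assign vcur (Tl_exp (Tl_exp (Var 0))))
     (Seq (Assign vout (Cons_exp (Var vcur) Nil_exp)) (Seq (Assign vouter (Var vgoal))
       (Seq (While (Var vouter) (Seq pass_com (Assign vouter (Tl_exp (Var vouter)))))
         (Assign 0 (Var vout))))))"

section \<open>Results, running times and frame conditions of the subroutines\<close>

definition keeps :: "nat set \<Rightarrow> store \<Rightarrow> store \<Rightarrow> bool" where
  "keeps X s s' \<longleftrightarrow> (\<forall>v. v \<notin> X \<longrightarrow> s' v = s v)"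

lemma keeps_refl: "keeps X s s"
  unfolding keeps_def by blast

lemma keeps_update_left [simp]: "v \<in> X \<Longrightarrow> keeps X (s(v := t)) s' \<longleftrightarrow> keeps X s s'"
  unfolding keeps_def by auto

lemma keeps_update: "keeps X s s' \<Longrightarrow> v \<in> X \<Longrightarrow> keeps X s (s'(v := t))"
  unfolding keeps_def by auto

definition eq_time :: "nat \<Rightarrow> nat" where
  "eq_time N = Suc N * 30"

lemma tot_eq:
  assumes "s vx = enc_nat m" "s vy = enc_nat n" "m \<le> N"
  shows "tot eq_com s (eq_time N) (\<lambda>s'. (s' vy = Leaf \<longleftrightarrow> m = n) \<and> keeps {vx, vy} s s')"
proof -
  have "tot eq_com s (eq_time m) (\<lambda>s'. (s' vy = Leaf \<longleftrightarrow> m = n) \<and> keeps {vx, vy} s s')"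
    using assms(1,2)
  proof (induction m arbitrary: n s)
    case 0
    then show ?case
      unfolding eq_com_def eq_time_def by (subst tot_While_iff) (auto simp: keeps_refl)
  next
    case (Suc m)
    show ?case
    proof (cases n)
      case 0
      then show ?thesis
        unfolding eq_com_def eq_time_def using Suc.prems
        apply (subst tot_While_iff)
        apply (simp add: tot_simps)
        apply (subst tot_While_iff)
        apply (simp add: keeps_refl keeps_update)
        done
    next
      case (Suc n')
      have "tot eq_com (s(vx := enc_nat m, vy := enc_nat n')) (eq_time m)
        (\<lambda>s'. (s' vy = Leaf \<longleftrightarrow> Suc m = n) \<and> keeps {vx, vy} s s')"
        using Suc by (intro tot_post[OF Suc.IH[of _ n']]) (auto simp: keeps_def)
      \<comment> \<open>One full iteration costs exactly 10: 2 for each of the two tests and 3 for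
        each of the two assignments.\<close>
      then have "tot eq_com (s(vx := enc_nat m, vy := enc_nat n')) (eq_time (Suc m) - 10)
        (\<lambda>s'. (s' vy = Leaf \<longleftrightarrow> Suc m = n) \<and> keeps {vx, vy} s s')"
        by (rule tot_weaken) (simp add: eq_time_def)
      then show ?thesis
        unfolding eq_com_def using Suc Suc.prems
        by (subst tot_While_iff) (simp add: tot_simps eq_time_def)
    qed
  qed
  then show ?thesis
    by (rule tot_weaken) (use assms(3) in \<open>simp add: eq_time_def\<close>)
qed

definition mem_time :: "nat \<Rightarrow> nat \<Rightarrow> nat" where
  "mem_time N L = 10 + Suc L * (50 + eq_time N)"

lemma tot_mem:
  assumes "s vR = enc_list enc_nat R" "s vz = enc_nat z" "length R \<le> L" "\<forall>r \<in> set R. r \<le> N"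
  shows "tot mem_com s (mem_time N L)
    (\<lambda>s'. (s' vflag \<noteq> Leaf \<longleftrightarrow> z \<in> set R) \<and> keeps {vx, vy, vscan, vflag} s s')"
proof -
  let ?X = "{vx, vy, vscan, vflag}"
  let ?rest = "Seq (If (Var vy) Skip (Assign vflag true_exp)) (Assign vscan (Tl_exp (Var vscan)))"
  let ?body = "Seq (Assign vx (Hd_exp (Var vscan))) (Seq (Assign vy (Var vz)) (Seq eq_com ?rest))"
  let ?P = "\<lambda>ys s'. (s' vflag \<noteq> Leaf \<or> z \<in> set ys \<longleftrightarrow> z \<in> set R) \<and> set ys \<subseteq> set R \<and> keeps ?X s s'"
  have body: "tot ?body s1 (48 + eq_time N) (\<lambda>s'. s' vscan = enc_list enc_nat ys \<and> ?P ys s')"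
    if s1: "s1 vscan = Node (enc_nat y) (enc_list enc_nat ys)" "?P (y # ys) s1" for y ys s1
  proof -
    have rest: "tot ?rest s' 20 (\<lambda>s'. s' vscan = enc_list enc_nat ys \<and> ?P ys s')"
      if s': "(s' vy = Leaf \<longleftrightarrow> y = z) \<and> keeps {vx, vy} s1 s'" for s'
    proof -
      have k: "keeps ?X s s'"
        using s1(2) s' by (auto simp: keeps_def)
      have "s' vscan = s1 vscan" "s' vflag = s1 vflag"
        using s' by (auto simp: keeps_def)
      then show ?thesis
        using s1 s' k by (auto simp: tot_simps keeps_update)
    qed
    have z: "s1 vz = enc_nat z"
      using s1(2) assms(2) by (auto simp: keeps_def)
    have y: "y \<le> N"
      using s1(2) assms(4) by auto
    show ?thesis
      by (rule tot_weaken, (rule tot_Seq tot_Assign)+, rule tot_post[OF tot_eq[of _ y z N] rest])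
        (simp_all add: s1(1) y z)
  qed
  show ?thesis
    unfolding mem_com_def
    by (rule tot_weaken, (rule tot_Seq tot_Assign)+,
        rule tot_post[OF tot_foreach[where f = enc_nat and P = ?P, OF _ _ assms(3) body]])
      (use assms(1) in \<open>auto simp: keeps_refl keeps_update mem_time_def\<close>)
qed

fun reach_step :: "(nat \<times> nat) list \<Rightarrow> nat list \<Rightarrow> nat list" where
  "reach_step [] R = R"
| "reach_step ((a, b) # ps) R = reach_step ps (if a \<in> set R then b # R else R)"

definition step_time :: "nat \<Rightarrow> nat \<Rightarrow> nat" where
  "step_time N L = 10 + Suc N * (50 + mem_time N L)"

lemma tot_step:
  assumes "s vcand = enc_list enc_pair ps" "s vR = enc_list enc_nat R" "length ps \<le> N"
    and "length R + length ps \<le> L" "\<forall>r \<in> set R. r \<le> N" "\<forall>p \<in> set ps. snd p \<le> N"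
  shows "tot step_com s (step_time N L) (\<lambda>s'. s' vR = enc_list enc_nat (reach_step ps R) \<and>
    keeps {vx, vy, varcs, vR, vscan, vflag, vz} s s')"
proof -
  let ?X = "{vx, vy, varcs, vR, vscan, vflag, vz}"
  let ?rest = "Seq (If (Var vflag) (Assign vR (Cons_exp (Tl_exp (Hd_exp (Var varcs))) (Var vR))) Skip)
    (Assign varcs (Tl_exp (Var varcs)))"
  let ?body = "Seq (Assign vz (Hd_exp (Hd_exp (Var varcs)))) (Seq mem_com ?rest)"
  \<comment> \<open>Each remaining arc adds at most one entry, so
    \<open>length R' + length ys\<close> never increases and keeps every list within
    \<open>L\<close>.\<close>
  let ?P = "\<lambda>ys s'. \<exists>R'. s' vR = enc_list enc_nat R' \<and> reach_step ys R' = reach_step ps R \<and>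
    length R' + length ys \<le> L \<and> (\<forall>r \<in> set R'. r \<le> N) \<and> set ys \<subseteq> set ps \<and> keeps ?X s s'"
  have body: "tot ?body s1 (48 + mem_time N L) (\<lambda>s'. s' varcs = enc_list enc_pair ys \<and> ?P ys s')"
    if s1: "s1 varcs = Node (enc_pair y) (enc_list enc_pair ys)" "?P (y # ys) s1" for y ys s1
  proof -
    obtain a b where y: "y = (a, b)"
      by (cases y)
    obtain R' where R': "s1 vR = enc_list enc_nat R'" "reach_step ((a, b) # ys) R' = reach_step ps R"
      "length R' + length ys < L" "\<forall>r \<in> set R'. r \<le> N" "(a, b) \<in> set ps" "set ys \<subseteq> set ps" "keeps ?X s s1"
      using s1(2) unfolding y by auto
    have rest: "tot ?rest s' 30 (\<lambda>s'. s' varcs = enc_list enc_pair ys \<and> ?P ys s')"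
      if s': "(s' vflag \<noteq> Leaf \<longleftrightarrow> a \<in> set R') \<and> keeps {vx, vy, vscan, vflag, vz} s1 s'" for s'
    proof -
      have k: "keeps ?X s s'"
        using R'(7) s' by (auto simp: keeps_def)
      have v: "s' varcs = Node (enc_pair (a, b)) (enc_list enc_pair ys)" "s' vR = enc_list enc_nat R'"
        using s' s1(1) R'(1) unfolding y by (auto simp: keeps_def)
      have P: "?P ys (s'(vR := enc_list enc_nat (if a \<in> set R' then b # R' else R'), varcs := t))" for t
        using R' k assms(6) by (intro exI[of _ "if a \<in> set R' then b # R' else R'"])
          (force intro!: keeps_update)
      show ?thesis
      proof (cases "a \<in> set R'")
        case True
        then show ?thesis
          using P[of "enc_list enc_pair ys"] s' v by (simp add: tot_simps enc_pair_def fun_upd_def cong: if_cong)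
      next
        case False
        have "s'(vR := enc_list enc_nat R') = s'"
          using v(2) by auto
        then show ?thesis
          using False P[of "enc_list enc_pair ys"] s' v by (simp add: tot_simps)
      qed
    qed
    show ?thesis
      by (rule tot_weaken, (rule tot_Seq tot_Assign)+,
          rule tot_post[OF tot_mem[of _ R' a L N] rest])
        (use s1(1) R' in \<open>auto simp: y enc_pair_def keeps_def\<close>)
  qed
  show ?thesis
    unfolding step_com_def
    by (rule tot_weaken, (rule tot_Seq tot_Assign)+,
        rule tot_post[OF tot_foreach[where f = enc_pair and P = ?P, OF _ _ assms(3) body]])
      (use assms in \<open>auto simp: keeps_refl keeps_update step_time_def\<close>)
qed

text \<open>Starting from one entry, at most \<open>N\<close> sweeps add at most \<open>N\<close>
  entries each, duplicates included; \<open>N * N + N + 1\<close> therefore bounds the list during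
  all sweeps and in the final lookup.\<close>

definition reach_time :: "nat \<Rightarrow> nat" where
  "reach_time N = 40 + Suc N * (12 + step_time N (N * N + N + 1)) + mem_time N (N * N + N + 1)"

lemma length_reach_step: "length (reach_step ps R) \<le> length R + length ps"
proof (induction ps R rule: reach_step.induct)
  case (2 a b ps R)
  then show ?case
    by (cases "a \<in> set R") auto
qed simp

lemma set_reach_step: "set (reach_step ps R) \<subseteq> set R \<union> snd ` set ps"
  by (induction ps R rule: reach_step.induct) (auto split: if_splits)

lemma tot_reach:
  assumes "s va = enc_nat a" "s vb = enc_nat b" "s vcand = enc_list enc_pair ps"
    and "s vgoal = enc_list enc_pair gs" "length ps \<le> N" "length gs \<le> N"
    and "a \<le> N" "\<forall>p \<in> set ps. snd p \<le> N"
  shows "tot reach_com s (reach_time N)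
    (\<lambda>s'. (s' vflag \<noteq> Leaf \<longleftrightarrow> b \<in> set ((reach_step ps ^^ length gs) [a])) \<and>
      keeps {vx, vy, vrounds, varcs, vR, vscan, vflag, vz} s s')"
proof -
  let ?X = "{vx, vy, vrounds, varcs, vR, vscan, vflag, vz}"
  let ?L = "N * N + N + 1"
  let ?F = "(reach_step ps ^^ length gs) [a]"
  let ?body = "Seq step_com (Assign vrounds (Tl_exp (Var vrounds)))"
  let ?P = "\<lambda>ys s'. \<exists>R. s' vR = enc_list enc_nat R \<and> (reach_step ps ^^ length ys) R = ?F \<and>
    length R + length ys * length ps \<le> N * N + 1 \<and> (\<forall>r \<in> set R. r \<le> N) \<and> keeps ?X s s'"
  have body: "tot ?body s1 (10 + step_time N ?L) (\<lambda>s'. s' vrounds = enc_list enc_pair ys \<and> ?P ys s')"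
    if s1: "s1 vrounds = Node (enc_pair y) (enc_list enc_pair ys)" "?P (y # ys) s1" for y ys s1
  proof -
    obtain R where R: "s1 vR = enc_list enc_nat R" "(reach_step ps ^^ Suc (length ys)) R = ?F"
      "length R + length (y # ys) * length ps \<le> N * N + 1" "\<forall>r \<in> set R. r \<le> N" "keeps ?X s s1"
      using s1(2) by auto
    have rest: "tot (Assign vrounds (Tl_exp (Var vrounds))) s' 10
        (\<lambda>s'. s' vrounds = enc_list enc_pair ys \<and> ?P ys s')"
      if s': "s' vR = enc_list enc_nat (reach_step ps R) \<and> keeps {vx, vy, varcs, vR, vscan, vflag, vz} s1 s'"
      for s'
    proof -
      have "keeps ?X s s'"
        using R(5) s' by (auto simp: keeps_def)
      moreover have "s' vrounds = s1 vrounds"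
        using s' by (auto simp: keeps_def)
      moreover have "length (reach_step ps R) + length ys * length ps \<le> N * N + 1"
        using R(3) length_reach_step[of ps R] by simp
      moreover have "\<forall>r \<in> set (reach_step ps R). r \<le> N"
        using R(4) set_reach_step[of ps R] assms(8) by auto
      moreover have "(reach_step ps ^^ length ys) (reach_step ps R) = ?F"
        using R(2) by (simp add: funpow_swap1)
      ultimately show ?thesis
        using s' s1(1) by (auto simp: tot_simps keeps_update)
    qed
    have "s1 vcand = enc_list enc_pair ps"
      using R(5) assms(3) by (auto simp: keeps_def)
    then show ?thesis
      using R(1,3,4) assms(5,8)
      by - (rule tot_weaken, rule tot_Seq,
          rule tot_post[OF tot_step[of _ ps R N ?L] rest], auto)
  qed
  have rest: "tot (Seq (Assign vz (Var vb)) mem_com) s' (10 + mem_time N ?L)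
      (\<lambda>s'. (s' vflag \<noteq> Leaf \<longleftrightarrow> b \<in> set ?F) \<and> keeps ?X s s')"
    if s': "s' vrounds = Leaf \<and> ?P [] s'" for s'
  proof -
    have R: "s' vR = enc_list enc_nat ?F" "length ?F \<le> ?L" "\<forall>r \<in> set ?F. r \<le> N" "keeps ?X s s'"
      using s' by auto
    have "s' vb = enc_nat b"
      using R(4) assms(2) by (auto simp: keeps_def)
    then show ?thesis
      using R
      by - (rule tot_weaken, (rule tot_Seq tot_Assign)+,
          rule tot_post[OF tot_mem[of _ ?F b ?L N]], auto simp: keeps_def)
  qed
  have "length gs * length ps \<le> N * N"
    using assms(5,6) by (intro mult_le_mono)
  then show ?thesis
    unfolding reach_com_def
    by - (rule tot_weaken, (rule tot_Seq tot_Assign)+,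
        rule tot_post[OF tot_foreach[where f = enc_pair and P = ?P, OF _ _ assms(6) body] rest],
        use assms in \<open>auto simp: keeps_refl keeps_update reach_time_def intro!: exI[of _ "[a]"]\<close>)
qed

definition split_time :: "nat \<Rightarrow> nat" where
  "split_time N = 40 + Suc N * 40"

lemma tot_split:
  assumes "s vinner = enc_list enc_pair js" "s vcur = enc_list enc_pair cs"
    and "s vgoal = enc_list enc_pair gs" "length js \<le> N" "length js \<le> length cs" "length js \<le> length gs"
  shows "tot split_com s (split_time N) (\<lambda>s'. s' vpre = enc_list enc_pair (rev (take (length js) cs)) \<and>
    s' vsuf = enc_list enc_pair (drop (length js) cs) \<and>
    s' vh = enc_list enc_pair (drop (length js) gs) \<and> keeps {vi, vpre, vsuf, vh} s s')"
proof -
  let ?X = "{vi, vpre, vsuf, vh}"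
  let ?body = "Seq (Assign vpre (Cons_exp (Hd_exp (Var vsuf)) (Var vpre)))
    (Seq (Assign vsuf (Tl_exp (Var vsuf))) (Seq (Assign vh (Tl_exp (Var vh)))
      (Assign vi (Tl_exp (Var vi)))))"
  let ?P = "\<lambda>ys s'. \<exists>k. k + length ys = length js \<and> s' vpre = enc_list enc_pair (rev (take k cs)) \<and>
    s' vsuf = enc_list enc_pair (drop k cs) \<and> s' vh = enc_list enc_pair (drop k gs) \<and> keeps ?X s s'"
  have body: "tot ?body s1 38 (\<lambda>s'. s' vi = enc_list enc_pair ys \<and> ?P ys s')"
    if s1: "s1 vi = Node (enc_pair y) (enc_list enc_pair ys)" "?P (y # ys) s1" for y ys s1
  proof -
    obtain k where k: "Suc k + length ys = length js" "s1 vpre = enc_list enc_pair (rev (take k cs))"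
      "s1 vsuf = enc_list enc_pair (drop k cs)" "s1 vh = enc_list enc_pair (drop k gs)" "keeps ?X s s1"
      using s1(2) by auto
    have "k < length cs" "k < length gs"
      using k(1) assms(5,6) by auto
    then have "s1 vsuf = Node (enc_pair (cs ! k)) (enc_list enc_pair (drop (Suc k) cs))"
      "s1 vh = Node (enc_pair (gs ! k)) (enc_list enc_pair (drop (Suc k) gs))"
      "enc_list enc_pair (rev (take (Suc k) cs)) = Node (enc_pair (cs ! k)) (s1 vpre)"
      using k(2-4) by (simp_all add: Cons_nth_drop_Suc[symmetric] take_Suc_conv_app_nth)
    then show ?thesis
      using s1(1) k(1,5) by (auto simp: tot_simps keeps_update intro!: exI[of _ "Suc k"])
  qed
  show ?thesis
    unfolding split_com_def
    by (rule tot_weaken, (rule tot_Seq tot_Assign)+,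
        rule tot_post[OF tot_foreach[where f = enc_pair and P = ?P, OF _ _ assms(4) body]])
      (use assms in \<open>auto simp: keeps_refl keeps_update split_time_def\<close>)
qed

definition join_time :: "nat \<Rightarrow> nat" where
  "join_time N = 20 + Suc N * 20"

lemma tot_join:
  assumes "s va = enc_nat a" "s vb = enc_nat b" "s vpre = enc_list enc_pair (rev (take i cs))"
    and "s vsuf = enc_list enc_pair (drop i cs)" "i < length cs" "length cs \<le> N"
  shows "tot join_com s (join_time N)
    (\<lambda>s'. s' vcand = enc_list enc_pair (cs[i := (b, a)]) \<and> keeps {vpre, vcand} s s')"
proof -
  let ?X = "{vpre, vcand}"
  let ?body = "Seq (Assign vcand (Cons_exp (Hd_exp (Var vpre)) (Var vcand))) (Assign vpre (Tl_exp (Var vpre)))"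
  \<comment> \<open>The stack \<open>ys\<close> holds the prefix still to be put in front of
    \<open>zs\<close>, hence the invariant concatenation.\<close>
  let ?P = "\<lambda>ys s'. \<exists>zs. s' vcand = enc_list enc_pair zs \<and> rev ys @ zs = cs[i := (b, a)] \<and> keeps ?X s s'"
  have body: "tot ?body s1 18 (\<lambda>s'. s' vpre = enc_list enc_pair ys \<and> ?P ys s')"
    if s1: "s1 vpre = Node (enc_pair y) (enc_list enc_pair ys)" "?P (y # ys) s1" for y ys s1
  proof -
    obtain zs where "s1 vcand = enc_list enc_pair zs" "rev (y # ys) @ zs = cs[i := (b, a)]" "keeps ?X s s1"
      using s1(2) by blast
    then show ?thesis
      using s1(1) by (auto simp: tot_simps keeps_update intro!: exI[of _ "y # zs"])
  qed
  have "length (rev (take i cs)) \<le> N"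
    using assms(6) by simp
  moreover have "s vsuf = Node (enc_pair (cs ! i)) (enc_list enc_pair (drop (Suc i) cs))"
    using assms(4,5) by (simp add: Cons_nth_drop_Suc[symmetric])
  ultimately show ?thesis
    unfolding join_com_def
    by - (rule tot_weaken, (rule tot_Seq tot_Assign)+,
        rule tot_post[OF tot_foreach[where f = enc_pair and P = ?P and xs = "rev (take i cs)", OF _ _ _ body]],
        use assms in \<open>auto simp: keeps_refl keeps_update join_time_def enc_pair_def
          upd_conv_take_nth_drop intro!: exI[of _ "(b, a) # drop (Suc i) cs"]\<close>)
qed

text \<open>The test exactly as the program performs it, on arc lists alone;
  \<open>flips_iff\<close> identifies it with a disagreement whose flip stays strong.\<close>

definition flips :: "(nat \<times> nat) list \<Rightarrow> nat \<Rightarrow> (nat \<times> nat) list \<Rightarrow> bool" where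
  "flips gs i cs \<longleftrightarrow> fst (cs ! i) \<noteq> fst (gs ! i) \<and>
    snd (cs ! i) \<in> set ((reach_step (cs[i := prod.swap (cs ! i)]) ^^ length gs) [fst (cs ! i)])"

definition try_time :: "nat \<Rightarrow> nat" where
  "try_time N = 100 + split_time N + eq_time N + join_time N + reach_time N"

abbreviation "try_vars \<equiv> {vcur, vout, vi, vpre, vsuf, vh, va, vb, vx, vy, vcand, vrounds, varcs,
  vR, vscan, vflag, vz}"

lemma tot_try:
  assumes "s vinner = enc_list enc_pair js" "s vcur = enc_list enc_pair cs"
    and "s vgoal = enc_list enc_pair gs" "length js < length cs" "length gs = length cs"
    and "length cs \<le> N" "\<forall>p \<in> set cs. fst p \<le> N \<and> snd p \<le> N" "\<forall>p \<in> set gs. fst p \<le> N \<and> snd p \<le> N"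
  shows "tot try_com s (try_time N) (\<lambda>s'. (if flips gs (length js) cs
      then s' vcur = enc_list enc_pair (cs[length js := prod.swap (cs ! length js)]) \<and>
        s' vout = Node (s' vcur) (s vout)
      else s' vcur = s vcur \<and> s' vout = s vout) \<and> keeps try_vars s s')" (is "tot _ _ _ ?Q")
proof -
  let ?i = "length js"
  obtain a b where ab: "cs ! ?i = (a, b)"
    by fastforce
  obtain c d where cd: "gs ! ?i = (c, d)"
    by fastforce
  have N: "a \<le> N" "b \<le> N" "c \<le> N"
    using assms(4,5,7,8) ab cd by (metis fst_conv snd_conv nth_mem)+
  let ?cs = "cs[?i := (b, a)]"
  have sw: "prod.swap (cs ! ?i) = (b, a)"
    using ab by simp
  have cs': "\<forall>p \<in> set ?cs. snd p \<le> N" "length ?cs \<le> N"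
    using N(1) assms(6,7) set_update_subset_insert[of cs ?i "(b, a)"] by auto
  \<comment> \<open>The verification runs from the last command backwards, so that each subroutine
    call gets the budgeted correctness of its continuation as postcondition. \<open>?B\<close>
    describes the state once the candidate is built, \<open>?A\<close> the state after the
    comparison of tails.\<close>
  let ?B = "\<lambda>s'. s' vcand = enc_list enc_pair ?cs \<and> s' vcur = s vcur \<and> s' vout = s vout \<and> keeps try_vars s s'"
  let ?if = "If (Var vflag) (Seq (Assign vcur (Var vcand)) (Assign vout (Cons_exp (Var vcand) (Var vout)))) Skip"
  have if_com: "tot ?if s' 20 ?Q"
    if "?B s'" "c \<noteq> a" "s' vflag \<noteq> Leaf \<longleftrightarrow> b \<in> set ((reach_step ?cs ^^ length gs) [a])" for s'
    using that unfolding flips_def sw unfolding ab cd by (auto simp: tot_simps keeps_update)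
  have reach: "tot (Seq reach_com ?if) s' (20 + reach_time N) ?Q"
    if s': "?B s'" "c \<noteq> a" "s' va = enc_nat a" "s' vb = enc_nat b" for s'
  proof -
    have "s' vgoal = enc_list enc_pair gs"
      using s'(1) assms(3) by (auto simp: keeps_def)
    then have "tot reach_com s' (reach_time N)
        (\<lambda>s''. (s'' vflag \<noteq> Leaf \<longleftrightarrow> b \<in> set ((reach_step ?cs ^^ length gs) [a])) \<and>
          keeps {vx, vy, vrounds, varcs, vR, vscan, vflag, vz} s' s'')"
      using s' cs' N(1) assms(5,6) by (intro tot_reach) auto
    then have "tot reach_com s' (reach_time N) (\<lambda>s''. tot ?if s'' 20 ?Q)"
    proof (rule tot_post)
      fix s'' assume s'': "(s'' vflag \<noteq> Leaf \<longleftrightarrow> b \<in> set ((reach_step ?cs ^^ length gs) [a])) \<and>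
        keeps {vx, vy, vrounds, varcs, vR, vscan, vflag, vz} s' s''"
      then have "?B s''"
        using s'(1) by (auto simp: keeps_def)
      then show "tot ?if s'' 20 ?Q"
        using s'' s'(2) by (intro if_com) auto
    qed
    then show ?thesis
      by (rule tot_weaken[OF tot_Seq]) simp
  qed
  let ?A = "\<lambda>s'. s' vpre = enc_list enc_pair (rev (take ?i cs)) \<and>
    s' vsuf = enc_list enc_pair (drop ?i cs) \<and> s' va = enc_nat a \<and> s' vb = enc_nat b \<and>
    keeps {vi, vpre, vsuf, vh, va, vb, vx, vy} s s'"
  let ?then = "Seq join_com (Seq reach_com ?if)"
  have join: "tot (If (Var vy) ?then Skip) s' (40 + join_time N + reach_time N) ?Q"
    if s': "?A s'" "s' vy = Leaf \<longleftrightarrow> c = a" for s'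
  proof (cases "c = a")
    case True
    have "s' vcur = s vcur" "s' vout = s vout" "keeps try_vars s s'"
      using s'(1) by (auto simp: keeps_def)
    then show ?thesis
      using True s'(2) unfolding flips_def ab cd by (auto simp: tot_simps)
  next
    case False
    have "tot join_com s' (join_time N)
        (\<lambda>s''. s'' vcand = enc_list enc_pair ?cs \<and> keeps {vpre, vcand} s' s'')"
      using s' assms(4,6) by (intro tot_join) auto
    then have "tot join_com s' (join_time N) (\<lambda>s''. tot (Seq reach_com ?if) s'' (20 + reach_time N) ?Q)"
    proof (rule tot_post)
      fix s'' assume s'': "s'' vcand = enc_list enc_pair ?cs \<and> keeps {vpre, vcand} s' s''"
      then have "?B s''"
        using s'(1) by (auto simp: keeps_def)
      moreover have "s'' va = s' va" "s'' vb = s' vb"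
        using s'' by (auto simp: keeps_def)
      ultimately show "tot (Seq reach_com ?if) s'' (20 + reach_time N) ?Q"
        using False s'(1) by (intro reach) auto
    qed
    from tot_Seq[OF this] have "tot ?then s' (38 + join_time N + reach_time N) ?Q"
      by (rule tot_weaken) simp
    note * = this
    have branch: "(if exp_val (Var vy) s' = Leaf then Skip else ?then) = ?then"
      using False s'(2) by simp
    show ?thesis
      unfolding tot_If_iff branch by (intro conjI tot_weaken[OF *]) simp_all
  qed
  let ?rest = "Seq (Assign va (Hd_exp (Hd_exp (Var vsuf)))) (Seq (Assign vb (Tl_exp (Hd_exp (Var vsuf))))
     (Seq (Assign vx (Hd_exp (Hd_exp (Var vh)))) (Seq (Assign vy (Var va)) (Seq eq_com
       (If (Var vy) ?then Skip)))))"
  have rest: "tot ?rest s' (60 + eq_time N + join_time N + reach_time N) ?Q"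
    if s': "s' vpre = enc_list enc_pair (rev (take ?i cs)) \<and>
      s' vsuf = enc_list enc_pair (drop ?i cs) \<and> s' vh = enc_list enc_pair (drop ?i gs) \<and>
      keeps {vi, vpre, vsuf, vh} s s'" for s'
  proof -
    have v: "s' vsuf = Node (enc_pair (a, b)) (enc_list enc_pair (drop (Suc ?i) cs))"
      "s' vh = Node (enc_pair (c, d)) (enc_list enc_pair (drop (Suc ?i) gs))"
      using s' assms(4,5) ab cd by (simp_all add: Cons_nth_drop_Suc[symmetric])
    let ?s = "s'(va := enc_nat a, vb := enc_nat b, vx := enc_nat c, vy := enc_nat a)"
    have "tot eq_com ?s (eq_time N) (\<lambda>s''. (s'' vy = Leaf \<longleftrightarrow> c = a) \<and> keeps {vx, vy} ?s s'')"
      using N(3) by (intro tot_eq) auto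
    then have "tot eq_com ?s (eq_time N)
        (\<lambda>s''. tot (If (Var vy) ?then Skip) s'' (40 + join_time N + reach_time N) ?Q)"
    proof (rule tot_post)
      fix s'' assume s'': "(s'' vy = Leaf \<longleftrightarrow> c = a) \<and> keeps {vx, vy} ?s s''"
      have "?A s''"
        using s' s'' by (auto simp: keeps_def)
      then show "tot (If (Var vy) ?then Skip) s'' (40 + join_time N + reach_time N) ?Q"
        using s'' by (intro join) auto
    qed
    from tot_Seq[OF this] show ?thesis
      using v by - (rule tot_weaken, rule tot_Seq, rule tot_Assign, rule tot_Seq, rule tot_Assign,
        rule tot_Seq, rule tot_Assign, rule tot_Seq, rule tot_Assign, auto simp: enc_pair_def)
  qed
  show ?thesis
    unfolding try_com_def
    by (rule tot_weaken, rule tot_Seq, rule tot_post[OF tot_split[of s js cs gs N] rest])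
      (use assms in \<open>auto simp: try_time_def\<close>)
qed

section \<open>Correctness of the program\<close>

lemma reach_step_mono: "set R \<subseteq> set (reach_step ps R)"
  by (induction ps R rule: reach_step.induct) (auto split: if_splits)

lemma reach_step_complete: "(x, y) \<in> set ps \<Longrightarrow> x \<in> set R \<Longrightarrow> y \<in> set (reach_step ps R)"
proof (induction ps R rule: reach_step.induct)
  case (2 a b ps R)
  show ?case
  proof (cases "(x, y) = (a, b)")
    case True
    then show ?thesis
      using "2.prems"(2) reach_step_mono[of "b # R" ps] by auto
  next
    case False
    then show ?thesis
      using 2 by auto
  qed
qed simp

lemma reach_step_sound:
  "set R \<subseteq> S \<Longrightarrow> \<forall>(x, y) \<in> set ps. x \<in> S \<longrightarrow> y \<in> S \<Longrightarrow> set (reach_step ps R) \<subseteq> S"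
  by (induction ps R rule: reach_step.induct) (auto split: if_splits)

text \<open>The right-hand side is the cut form that \<open>strong_flip_iff\<close> calls for. A
  sweep from a set that is not closed gains a vertex, and only \<open>a\<close> and the heads of
  \<open>ps\<close> can ever occur, so \<open>length ps\<close> sweeps suffice.\<close>

lemma reach_iff:
  "b \<in> set ((reach_step ps ^^ length ps) [a]) \<longleftrightarrow>
    (\<forall>S. a \<in> S \<longrightarrow> (\<forall>(x, y) \<in> set ps. x \<in> S \<longrightarrow> y \<in> S) \<longrightarrow> b \<in> S)"
proof -
  let ?C = "\<lambda>S. \<forall>(x, y) \<in> set ps. x \<in> S \<longrightarrow> y \<in> S"
  define R where "R k = (reach_step ps ^^ k) [a]" for k
  have Suc: "R (Suc k) = reach_step ps (R k)" for k
    unfolding R_def by simp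
  have a: "a \<in> set (R k)" for k
  proof (induction k)
    case (Suc k)
    then show ?case
      unfolding \<open>R (Suc k) = reach_step ps (R k)\<close> using reach_step_mono by blast
  qed (simp add: R_def)
  have sound: "set (R k) \<subseteq> S" if "a \<in> S" "?C S" for S k
  proof (induction k)
    case (Suc k)
    then show ?case
      unfolding \<open>R (Suc k) = reach_step ps (R k)\<close> using that(2) by (rule reach_step_sound)
  qed (use that(1) in \<open>simp add: R_def\<close>)
  have heads: "set (R k) \<subseteq> insert a (snd ` set ps)" for k
    by (rule sound) (force simp: image_iff)+
  have grow: "?C (set (R k)) \<or> k < card (set (R k))" for k
  proof (induction k)
    case 0
    then show ?case
      by (simp add: R_def)
  next
    case (Suc k)
    show ?case
    proof (cases "?C (set (R k))")
      case True
      then have "set (R (Suc k)) = set (R k)"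
        using sound[OF a True] reach_step_mono[of "R k" ps] reach_step_sound[of "R k" "set (R k)" ps]
        unfolding \<open>R (Suc k) = reach_step ps (R k)\<close> by auto
      then show ?thesis
        using True by simp
    next
      case False
      then obtain x y where xy: "(x, y) \<in> set ps" "x \<in> set (R k)" "y \<notin> set (R k)"
        by auto
      have "set (R k) \<subset> set (R (Suc k))"
        unfolding \<open>R (Suc k) = reach_step ps (R k)\<close>
        using reach_step_complete[OF xy(1,2)] reach_step_mono[of "R k" ps] xy(3) by blast
      then have "card (set (R k)) < card (set (R (Suc k)))"
        by (intro psubset_card_mono) auto
      then show ?thesis
        using Suc False by linarith
    qed
  qed
  have closed: "?C (set (R (length ps)))"
  proof (cases "?C (set (R (length ps)))")
    case False
    \<comment> \<open>The strict inequality in \<open>grow\<close> makes up for the start vertex.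
      Without closure, \<open>a\<close> and all heads would have been collected, and that set is
      closed after all.\<close>
    have "card (insert a (snd ` set ps)) \<le> Suc (card (snd ` set ps))"
      by (simp add: card_insert_if)
    also have "\<dots> \<le> Suc (length ps)"
      using card_image_le[of "set ps" snd] card_length[of ps] by simp
    also have "\<dots> \<le> card (set (R (length ps)))"
      using grow[of "length ps"] False by auto
    finally have "set (R (length ps)) = insert a (snd ` set ps)"
      using heads by (intro card_seteq) auto
    then show ?thesis
      by force
  qed blast
  show ?thesis
    unfolding R_def[symmetric]
  proof
    show "\<forall>S. a \<in> S \<longrightarrow> ?C S \<longrightarrow> b \<in> S" if "b \<in> set (R (length ps))"
      using that sound by blast
    show "b \<in> set (R (length ps))" if "\<forall>S. a \<in> S \<longrightarrow> ?C S \<longrightarrow> b \<in> S"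
      using that a closed by blast
  qed
qed

lemma enc_list_map: "enc_list (\<lambda>x. f (g x)) xs = enc_list f (map g xs)"
  by (induction xs) auto

definition pass_time :: "nat \<Rightarrow> nat" where
  "pass_time N = 20 + Suc N * (10 + try_time N)"

definition main_time :: "nat \<Rightarrow> nat" where
  "main_time N = 60 + Suc N * (12 + pass_time N)"

section \<open>The program on an unblocked instance\<close>

context
  fixes G :: "(nat, nat) multigraph" and D1 D2 :: "(nat, nat) pre_digraph" and m N :: nat
  assumes G: "multigraph G" "standard_instance G"
    and D1: "strong_orientation G D1" and D2: "strong_orientation G D2"
    and unblocked: "\<not> blocked G D1 D2"
  defines "m \<equiv> card (edges G)"
  defines "N \<equiv> card (vertices G) + card (edges G)"
begin

definition arc_list :: "(nat, nat) pre_digraph \<Rightarrow> (nat \<times> nat) list" where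
  "arc_list D = map (arc_to_ends D) [0..<m]"

lemma edges_eq: "e \<in> edges G \<longleftrightarrow> e < m"
  using G(2) unfolding standard_instance_def m_def by (metis lessThan_iff)

lemma vertices_le: "v \<in> vertices G \<Longrightarrow> v \<le> N"
  using G(2) unfolding standard_instance_def N_def by (metis lessThan_iff le_SucI less_imp_le trans_le_add1)

lemma m_le: "m \<le> N"
  unfolding m_def N_def by simp

lemma enc_orientation_eq:
  assumes "orientation G D"
  shows "enc_orientation D = enc_list enc_pair (arc_list D)"
  using orientationD(2)[OF G(1) assms]
  unfolding enc_orientation_def arc_list_def by (simp add: enc_list_map m_def)

lemma length_arc_list: "length (arc_list D) = m"
  unfolding arc_list_def by simp

lemma nth_arc_list: "i < m \<Longrightarrow> arc_list D ! i = (tail D i, head D i)"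
  unfolding arc_list_def arc_to_ends_def by simp

lemma arc_list_le:
  assumes "orientation G D"
  shows "\<forall>p \<in> set (arc_list D). fst p \<le> N \<and> snd p \<le> N"
  using orientationD(7,8)[OF G(1) assms] vertices_le
  unfolding arc_list_def arc_to_ends_def by (auto simp: edges_eq)

lemma arc_list_flip:
  assumes "j < m"
  shows "(arc_list D)[j := prod.swap (arc_list D ! j)] = arc_list (flip j D)"
  by (rule nth_equalityI) (use assms in \<open>auto simp: length_arc_list nth_arc_list nth_list_update\<close>)

lemma reach_iff_strong_flip:
  assumes D: "strong_orientation G D" and j: "j < m"
  shows "head D j \<in> set ((reach_step (arc_list (flip j D)) ^^ m) [tail D j]) \<longleftrightarrow> strong (flip j D)"
proof -
  have o: "orientation G D" "strong D"
    using D strong_orientationD by auto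
  have e: "j \<in> edges G"
    using j edges_eq by simp
  note oD = orientationD[OF G(1) o(1)]
  let ?ps = "arc_list (flip j D)"
  \<comment> \<open>The arc lists differ in arc \<open>j\<close> only, and its reversal points at
    the start vertex, which already lies in \<open>S\<close>.\<close>
  have closed: "(\<forall>(x, y) \<in> set ?ps. x \<in> S \<longrightarrow> y \<in> S) \<longleftrightarrow>
      (\<forall>a \<in> edges G. a \<noteq> j \<longrightarrow> tail D a \<in> S \<longrightarrow> head D a \<in> S)" if "tail D j \<in> S" for S
    using that e unfolding arc_list_def arc_to_ends_def by (auto simp: edges_eq)
  have "strong (flip j D) \<longleftrightarrow> (\<forall>S. tail D j \<in> S \<longrightarrow>
      (\<forall>a \<in> edges G. a \<noteq> j \<longrightarrow> tail D a \<in> S \<longrightarrow> head D a \<in> S) \<longrightarrow> head D j \<in> S)" (is "_ \<longleftrightarrow> ?R")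
    unfolding strong_flip_iff[OF G(1) o e]
  proof
    assume L: "\<not> (\<exists>S. S \<subseteq> vertices G \<and> tail D j \<in> S \<and> head D j \<notin> S \<and>
      (\<forall>a \<in> edges G. a \<noteq> j \<longrightarrow> tail D a \<in> S \<longrightarrow> head D a \<in> S))"
    show ?R
    proof (intro allI impI, rule ccontr)
      fix S assume S: "tail D j \<in> S" "\<forall>a \<in> edges G. a \<noteq> j \<longrightarrow> tail D a \<in> S \<longrightarrow> head D a \<in> S"
        "head D j \<notin> S"
      \<comment> \<open>The closed sets of \<open>reach_iff\<close> range over all sets of naturals;
        intersecting with the vertices keeps them closed, since heads of arcs are vertices.\<close>
      have "S \<inter> vertices G \<subseteq> vertices G \<and> tail D j \<in> S \<inter> vertices G \<and> head D j \<notin> S \<inter> vertices G \<and>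
        (\<forall>a \<in> edges G. a \<noteq> j \<longrightarrow> tail D a \<in> S \<inter> vertices G \<longrightarrow> head D a \<in> S \<inter> vertices G)"
        using S oD(7)[OF e] oD(8) by blast
      then show False
        using L by blast
    qed
  qed blast
  moreover have "head D j \<in> set ((reach_step ?ps ^^ m) [tail D j]) \<longleftrightarrow>
      (\<forall>S. tail D j \<in> S \<longrightarrow> (\<forall>(x, y) \<in> set ?ps. x \<in> S \<longrightarrow> y \<in> S) \<longrightarrow> head D j \<in> S)"
    using reach_iff[of "head D j" ?ps "tail D j"] unfolding length_arc_list .
  moreover have "\<dots> \<longleftrightarrow> ?R"
    by (intro iff_allI imp_cong refl, rule closed)
  ultimately show ?thesis
    by simp
qed

lemma flips_iff:
  assumes "strong_orientation G D" "j < m"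
  shows "flips (arc_list D1) j (arc_list D) \<longleftrightarrow> j \<in> diff G D D1 \<and> strong (flip j D)"
  unfolding flips_def arc_list_flip[OF assms(2)] length_arc_list
  using reach_iff_strong_flip[OF assms] assms(2)
  by (simp add: nth_arc_list diff_def edges_eq)

text \<open>\<open>K\<close> is only an upper bound: a pass may flip several edges, while the proof
  counts one.\<close>

definition state_ok :: "nat \<Rightarrow> (nat, nat) pre_digraph \<Rightarrow> store \<Rightarrow> bool" where
  "state_ok K D s \<longleftrightarrow> s vcur = enc_orientation D \<and> s vgoal = enc_orientation D1 \<and>
     (\<exists>p. s vout = enc_path p \<and> progress G D1 D2 D p) \<and> card (diff G D D1) \<le> K"

lemma tot_try_orientation:
  assumes "state_ok K D s" "s vinner = enc_list enc_pair js" "length js < m"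
  shows "tot try_com s (try_time N) (\<lambda>s'. keeps try_vars s s' \<and>
    (\<exists>D'. state_ok K D' s' \<and> (card (diff G D' D1) < card (diff G D D1) \<or>
      D' = D \<and> (length js \<in> diff G D D1 \<longrightarrow> \<not> strong (flip (length js) D)))))"
proof -
  obtain p where s: "s vcur = enc_orientation D" "s vgoal = enc_orientation D1"
    "s vout = enc_path p" "progress G D1 D2 D p" "card (diff G D D1) \<le> K"
    using assms(1) unfolding state_ok_def by blast
  let ?j = "length js"
  have D: "strong_orientation G D"
    using s(4) unfolding progress_def by blast
  note o = strong_orientationD(1)[OF D] strong_orientationD(1)[OF D1]
  have "tot try_com s (try_time N) (\<lambda>s'. (if flips (arc_list D1) ?j (arc_list D)
      then s' vcur = enc_list enc_pair (arc_list (flip ?j D)) \<and> s' vout = Node (s' vcur) (s vout)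
      else s' vcur = s vcur \<and> s' vout = s vout) \<and> keeps try_vars s s')"
    using tot_try[of s js "arc_list D" "arc_list D1" N] s(1,2) assms(2,3) m_le
      arc_list_le[OF o(1)] arc_list_le[OF o(2)]
    unfolding enc_orientation_eq[OF o(1)] enc_orientation_eq[OF o(2)] length_arc_list
      arc_list_flip[OF assms(3)] by blast
  then show ?thesis
  proof (rule tot_post)
    fix s' assume s': "(if flips (arc_list D1) ?j (arc_list D)
      then s' vcur = enc_list enc_pair (arc_list (flip ?j D)) \<and> s' vout = Node (s' vcur) (s vout)
      else s' vcur = s vcur \<and> s' vout = s vout) \<and> keeps try_vars s s'"
    have goal: "s' vgoal = enc_orientation D1"
      using s' s(2) by (auto simp: keeps_def)
    show "keeps try_vars s s' \<and> (\<exists>D'. state_ok K D' s' \<and> (card (diff G D' D1) < card (diff G D D1) \<or>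
      D' = D \<and> (length js \<in> diff G D D1 \<longrightarrow> \<not> strong (flip (length js) D))))"
    proof (cases "flips (arc_list D1) ?j (arc_list D)")
      case True
      then have flip: "?j \<in> diff G D D1" "strong (flip ?j D)"
        using flips_iff[OF D assms(3)] by auto
      note pf = progress_flip[OF G(1) D1 s(4) flip]
      have "s' vcur = enc_orientation (flip ?j D)"
        using s' True orientation_flip[OF o(1)] assms(3) by (simp add: enc_orientation_eq edges_eq)
      moreover from this have "s' vout = enc_path (flip ?j D # p)"
        using s' True s(3) by (simp add: enc_path_def)
      ultimately have "state_ok K (flip ?j D) s'"
        unfolding state_ok_def using pf s(5) goal by auto
      then show ?thesis
        using s' pf(2) by blast
    next
      case False
      then have "state_ok K D s'"
        unfolding state_ok_def using s s' goal by auto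
      then show ?thesis
        using s' False flips_iff[OF D assms(3)] by auto
    qed
  qed
qed

lemma tot_pass:
  assumes "state_ok (Suc K) D s"
  shows "tot pass_com s (pass_time N) (\<lambda>s'. keeps (insert vinner try_vars) s s' \<and> (\<exists>D'. state_ok K D' s'))"
proof -
  let ?X = "insert vinner try_vars"
  \<comment> \<open>Either at most \<open>K\<close> disagreements are left, or no disagreement
    tested so far can be flipped in the current orientation. A flip establishes the former; without
    one the orientation stays the same and earlier failures remain valid.\<close>
  let ?P = "\<lambda>(ys :: (nat \<times> nat) list) s'. length ys \<le> m \<and> keeps ?X s s' \<and> (\<exists>D'. state_ok (Suc K) D' s' \<and>
    (card (diff G D' D1) \<le> K \<or> (\<forall>j \<in> diff G D' D1. length ys \<le> j \<longrightarrow> \<not> strong (flip j D'))))"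
  let ?body = "Seq (Assign vinner (Tl_exp (Var vinner))) try_com"
  have body: "tot ?body s1 (8 + try_time N) (\<lambda>s'. s' vinner = enc_list enc_pair ys \<and> ?P ys s')"
    if s1: "s1 vinner = Node (enc_pair y) (enc_list enc_pair ys)" "?P (y # ys) s1" for y ys s1
  proof -
    obtain D' where D': "state_ok (Suc K) D' s1"
      "card (diff G D' D1) \<le> K \<or> (\<forall>j \<in> diff G D' D1. Suc (length ys) \<le> j \<longrightarrow> \<not> strong (flip j D'))"
      using s1(2) by auto
    let ?s = "s1(vinner := enc_list enc_pair ys)"
    have "tot try_com ?s (try_time N) (\<lambda>s'. keeps try_vars ?s s' \<and>
      (\<exists>D''. state_ok (Suc K) D'' s' \<and> (card (diff G D'' D1) < card (diff G D' D1) \<or>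
        D'' = D' \<and> (length ys \<in> diff G D' D1 \<longrightarrow> \<not> strong (flip (length ys) D')))))"
      using D'(1) s1(2) by (intro tot_try_orientation) (auto simp: state_ok_def)
    then have "tot try_com ?s (try_time N) (\<lambda>s'. s' vinner = enc_list enc_pair ys \<and> ?P ys s')"
    proof (rule tot_post)
      fix s' assume s': "keeps try_vars ?s s' \<and>
        (\<exists>D''. state_ok (Suc K) D'' s' \<and> (card (diff G D'' D1) < card (diff G D' D1) \<or>
          D'' = D' \<and> (length ys \<in> diff G D' D1 \<longrightarrow> \<not> strong (flip (length ys) D'))))"
      then obtain D'' where D'': "state_ok (Suc K) D'' s'" "card (diff G D'' D1) < card (diff G D' D1) \<or>
          D'' = D' \<and> (length ys \<in> diff G D' D1 \<longrightarrow> \<not> strong (flip (length ys) D'))"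
        by blast
      have "s' vinner = enc_list enc_pair ys" "keeps ?X s s'" "length ys \<le> m"
        using s' s1(2) by (auto simp: keeps_def)
      moreover have "card (diff G D'' D1) \<le> K \<or>
          (\<forall>j \<in> diff G D'' D1. length ys \<le> j \<longrightarrow> \<not> strong (flip j D''))"
      proof (cases "card (diff G D'' D1) < card (diff G D' D1)")
        case True
        then show ?thesis
          using D'(1) unfolding state_ok_def by linarith
      next
        case False
        then have "D'' = D'" "length ys \<in> diff G D' D1 \<longrightarrow> \<not> strong (flip (length ys) D')"
          using D''(2) by auto
        then show ?thesis
          using D'(2) by (metis Suc_leI le_neq_implies_less)
      qed
      ultimately show "s' vinner = enc_list enc_pair ys \<and> ?P ys s'"
        using D''(1) by blast
    qed
    then show ?thesis
      using s1(1) by - (rule tot_weaken, rule tot_Seq, rule tot_Assign, auto)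
  qed
  have goal: "s vgoal = enc_list enc_pair (arc_list D1)"
    using assms enc_orientation_eq[OF strong_orientationD(1)[OF D1]] unfolding state_ok_def by simp
  let ?s = "s(vinner := enc_list enc_pair (arc_list D1))"
  have start: "?P (arc_list D1) ?s"
  proof -
    have "\<not> length (arc_list D1) \<le> j" if "j \<in> diff G D D1" for j
      using that by (auto simp: length_arc_list diff_def edges_eq)
    moreover have "state_ok (Suc K) D ?s"
      using assms by (simp add: state_ok_def)
    ultimately show ?thesis
      by (auto simp: length_arc_list keeps_refl keeps_update)
  qed
  have "tot (While (Var vinner) ?body) ?s (Suc N * (2 + (8 + try_time N))) (\<lambda>s'. s' vinner = Leaf \<and> ?P [] s')"
    by (rule tot_foreach[where f = enc_pair and P = ?P, OF _ start _ body])
      (auto simp: length_arc_list m_le)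
  then have "tot (While (Var vinner) ?body) ?s (Suc N * (2 + (8 + try_time N)))
    (\<lambda>s'. keeps (insert vinner try_vars) s s' \<and> (\<exists>D'. state_ok K D' s'))"
  proof (rule tot_post)
    fix s' assume "s' vinner = Leaf \<and> ?P [] s'"
    then obtain D' where D': "keeps ?X s s'" "state_ok (Suc K) D' s'"
      "card (diff G D' D1) \<le> K \<or> (\<forall>j \<in> diff G D' D1. \<not> strong (flip j D'))"
      by auto
    then obtain p where "progress G D1 D2 D' p"
      unfolding state_ok_def by blast
    \<comment> \<open>After a whole pass the second alternative covers every index, and by
      \<open>progress_flippable\<close> there is then no disagreement at all.\<close>
    then have "card (diff G D' D1) \<le> K"
      using D'(3) progress_flippable[OF G(1) D1 unblocked] by (metis card.empty le0)
    then have "state_ok K D' s'"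
      using D'(2) unfolding state_ok_def by blast
    then show "keeps (insert vinner try_vars) s s' \<and> (\<exists>D'. state_ok K D' s')"
      using D'(1) by blast
  qed
  then show ?thesis
    unfolding pass_com_def
    by - (rule tot_weaken, rule tot_Seq, rule tot_Assign, auto simp: goal pass_time_def)
qed

lemma tot_main:
  assumes "s 0 = enc_instance G D1 D2"
  shows "tot main_com s (main_time N) (\<lambda>s'. \<exists>p. s' 0 = enc_path p \<and> shortest_flip_path G D1 p D2)"
    (is "tot _ _ _ ?Q")
proof -
  let ?P = "\<lambda>(ys :: (nat \<times> nat) list) s'. \<exists>D. state_ok (length ys) D s'"
  let ?body = "Seq pass_com (Assign vouter (Tl_exp (Var vouter)))"
  have body: "tot ?body s1 (10 + pass_time N) (\<lambda>s'. s' vouter = enc_list enc_pair ys \<and> ?P ys s')"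
    if s1: "s1 vouter = Node (enc_pair y) (enc_list enc_pair ys)" "?P (y # ys) s1" for y ys s1
  proof -
    obtain D where "state_ok (Suc (length ys)) D s1"
      using s1(2) by auto
    from tot_pass[OF this] have "tot pass_com s1 (pass_time N)
      (\<lambda>s'. tot (Assign vouter (Tl_exp (Var vouter))) s' 10 (\<lambda>s'. s' vouter = enc_list enc_pair ys \<and> ?P ys s'))"
    proof (rule tot_post)
      fix s' assume s': "keeps (insert vinner try_vars) s1 s' \<and> (\<exists>D'. state_ok (length ys) D' s')"
      then have "s' vouter = s1 vouter"
        by (auto simp: keeps_def)
      then show "tot (Assign vouter (Tl_exp (Var vouter))) s' 10
          (\<lambda>s'. s' vouter = enc_list enc_pair ys \<and> ?P ys s')"
        using s' s1(1) by (auto simp: tot_Assign_iff state_ok_def)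
    qed
    then show ?thesis
      by (rule tot_weaken[OF tot_Seq]) simp
  qed
  let ?s = "s(vgoal := enc_orientation D1, vcur := enc_orientation D2, vout := enc_path [D2],
    vouter := enc_orientation D1)"
  have outer: "?s vouter = enc_list enc_pair (arc_list D1)"
    using enc_orientation_eq[OF strong_orientationD(1)[OF D1]] by simp
  \<comment> \<open>There are at most \<open>m\<close> disagreements at the start and each of the
    \<open>m\<close> passes lowers the bound by one, so it ends at 0.\<close>
  have "diff G D2 D1 \<subseteq> {..<m}"
    unfolding diff_def by (auto simp: edges_eq)
  from card_mono[OF _ this] have "card (diff G D2 D1) \<le> m"
    by simp
  then have start: "?P (arc_list D1) ?s"
    using progress_start[OF D2] unfolding state_ok_def length_arc_list by auto
  have "tot (While (Var vouter) ?body) ?s (Suc N * (2 + (10 + pass_time N))) (\<lambda>s'. s' vouter = Leaf \<and> ?P [] s')"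
    by (rule tot_foreach[where f = enc_pair and P = ?P, OF outer start _ body])
      (auto simp: length_arc_list m_le)
  then have "tot (While (Var vouter) ?body) ?s (Suc N * (2 + (10 + pass_time N)))
    (\<lambda>s'. tot (Assign 0 (Var vout)) s' 10 ?Q)"
  proof (rule tot_post)
    fix s' assume "s' vouter = Leaf \<and> ?P [] s'"
    then obtain D p where D: "s' vout = enc_path p" "progress G D1 D2 D p" "card (diff G D D1) = 0"
      unfolding state_ok_def by auto
    then have "shortest_flip_path G D1 p D2"
      using progress_finish[OF G(1) D1 D(2)] finite_diff[OF G(1)] by simp
    then show "tot (Assign 0 (Var vout)) s' 10 ?Q"
      using D(1) by (auto simp: tot_Assign_iff)
  qed
  from tot_Seq[OF this] show ?thesis
    unfolding main_com_def using assms
    by - (rule tot_weaken, rule tot_Seq, rule tot_Assign, rule tot_Seq, rule tot_Assign,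
      rule tot_Seq, rule tot_Assign, rule tot_Seq, rule tot_Assign,
      auto simp: enc_instance_def enc_path_def main_time_def)
qed

end

section \<open>Polynomial running time\<close>

definition poly_bound :: "(nat \<Rightarrow> nat) \<Rightarrow> bool" where
  "poly_bound f \<longleftrightarrow> (\<exists>p. \<forall>n. poly p n = f n)"

lemma poly_bound_const: "poly_bound (\<lambda>n. c)"
  unfolding poly_bound_def by (intro exI[of _ "[:c:]"]) simp

lemma poly_bound_id: "poly_bound (\<lambda>n. n)"
  unfolding poly_bound_def by (intro exI[of _ "[:0, 1:]"]) simp

lemma poly_bound_add: "poly_bound f \<Longrightarrow> poly_bound g \<Longrightarrow> poly_bound (\<lambda>n. f n + g n)"
  unfolding poly_bound_def by (metis poly_add)

lemma poly_bound_mult: "poly_bound f \<Longrightarrow> poly_bound g \<Longrightarrow> poly_bound (\<lambda>n. f n * g n)"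
  unfolding poly_bound_def by (metis poly_mult)

text \<open>With \<open>Suc\<close> unfolded, every budget is built from \<open>N\<close> and
  constants by sums and products, so it equals a polynomial exactly.\<close>

lemma poly_bound_main_time: "poly_bound main_time"
  unfolding main_time_def[abs_def] pass_time_def try_time_def split_time_def eq_time_def join_time_def
    reach_time_def step_time_def mem_time_def Suc_eq_plus1
  by (intro poly_bound_add poly_bound_mult poly_bound_const poly_bound_id)

theorem theorem3:
  shows "(\<forall>(G :: ('v, 'e) multigraph) D1 D2.
      multigraph G \<and> edge_connected 2 G \<and> strong_orientation G D1 \<and> strong_orientation G D2 \<longrightarrow>
      ((\<exists>p. flip_path G D1 p D2) \<longleftrightarrow>
       \<not> (\<exists>e f u v u' v'. two_edge_cut G {e, f} \<and>
            arc_to_ends D1 e = (u, v) \<and> arc_to_ends D1 f = (v', u') \<and>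
            arc_to_ends D2 e = (v, u) \<and> arc_to_ends D2 f = (u', v')))) \<and>
    (\<exists>(c :: com) (b :: nat poly). \<forall>(G :: (nat, nat) multigraph) D1 D2.
      multigraph G \<and> standard_instance G \<and> edge_connected 2 G \<and>
      strong_orientation G D1 \<and> strong_orientation G D2 \<and> (\<exists>p. flip_path G D1 p D2) \<longrightarrow>
      (\<exists>p. shortest_flip_path G D1 p D2 \<and>
           computes_within c (enc_instance G D1 D2)
             (poly b (card (vertices G) + card (edges G))) (enc_path p)))"
proof (intro conjI)
  show "\<forall>(G :: ('v, 'e) multigraph) D1 D2.
      multigraph G \<and> edge_connected 2 G \<and> strong_orientation G D1 \<and> strong_orientation G D2 \<longrightarrow>
      ((\<exists>p. flip_path G D1 p D2) \<longleftrightarrow>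
       \<not> (\<exists>e f u v u' v'. two_edge_cut G {e, f} \<and>
            arc_to_ends D1 e = (u, v) \<and> arc_to_ends D1 f = (v', u') \<and>
            arc_to_ends D2 e = (v, u) \<and> arc_to_ends D2 f = (u', v')))"
  proof (intro allI impI, elim conjE)
    fix G :: "('v, 'e) multigraph" and D1 D2
    assume *: "multigraph G" "strong_orientation G D1" "strong_orientation G D2"
    show "(\<exists>p. flip_path G D1 p D2) \<longleftrightarrow>
       \<not> (\<exists>e f u v u' v'. two_edge_cut G {e, f} \<and>
            arc_to_ends D1 e = (u, v) \<and> arc_to_ends D1 f = (v', u') \<and>
            arc_to_ends D2 e = (v, u) \<and> arc_to_ends D2 f = (u', v'))"
      unfolding blocked_iff_reversed_cut[OF *(1) *(2,3)[THEN strong_orientationD(1)], symmetric]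
      using flip_path_exists[OF *] flip_path_not_blocked[OF *(1)] by blast
  qed
  obtain b where b: "\<And>n. poly b n = main_time n"
    using poly_bound_main_time unfolding poly_bound_def by blast
  show "\<exists>(c :: com) (b :: nat poly). \<forall>(G :: (nat, nat) multigraph) D1 D2.
      multigraph G \<and> standard_instance G \<and> edge_connected 2 G \<and>
      strong_orientation G D1 \<and> strong_orientation G D2 \<and> (\<exists>p. flip_path G D1 p D2) \<longrightarrow>
      (\<exists>p. shortest_flip_path G D1 p D2 \<and>
           computes_within c (enc_instance G D1 D2)
             (poly b (card (vertices G) + card (edges G))) (enc_path p))"
  proof (intro exI[of _ main_com] exI[of _ b] allI impI, elim conjE)
    fix G :: "(nat, nat) multigraph" and D1 D2
    assume *: "multigraph G" "standard_instance G" "strong_orientation G D1" "strong_orientation G D2"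
      and "\<exists>p. flip_path G D1 p D2"
    then have "\<not> blocked G D1 D2"
      using flip_path_not_blocked by blast
    from tot_main[OF * this, of "(\<lambda>_. Leaf)(0 := enc_instance G D1 D2)"]
    show "\<exists>p. shortest_flip_path G D1 p D2 \<and> computes_within main_com (enc_instance G D1 D2)
        (poly b (card (vertices G) + card (edges G))) (enc_path p)"
      unfolding tot_def computes_within_def b by auto
  qed
qed

end
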